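(* Let $N$ be a positive integer such that $\varphi^*(N)$ divides $N$, and suppose that $N$ is not one of the twelve integers $1$, $2$, $2\cdot 3$, $2^2\cdot 3$, $2^3\cdot 3\cdot 7$, $2^4\cdot 3\cdot 5$, $2^5\cdot 3\cdot 5\cdot 31$, $2^8\cdot 3\cdot 5\cdot 17$, $2^{11}\cdot 3\cdot 5\cdot 11^2\cdot 23\cdot 89$, $2^{16}\cdot 3\cdot 5\cdot 17\cdot 257$, $2^{17}\cdot 3\cdot 5\cdot 17\cdot 257\cdot 131071$, $2^{32}\cdot 3\cdot 5\cdot 17\cdot 257\cdot 65537$. Then $\omega(N)\geq 8$.
   Context: For a positive integer $N$, the unitary totient is $\varphi^*(N)=\prod_{p^e\mid\mid N}(p^e-1)$, the product being over all prime powers $p^e$ ($e\ge 1$) exactly dividing $N$ (i.e. $p^e\mid N$, $p^{e+1}\nmid N$); $\varphi^*(1)=1$. $\omega(N)$ denotes the number of distinct prime factors of $N$. *)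

theory Defs
  imports "HOL-Computational_Algebra.Computational_Algebra"
begin

text \<open>
  The prime powers exactly dividing \<open>N > 0\<close> are the \<open>p ^ multiplicity p N\<close> with \<open>p\<close> a prime factor
  of \<open>N\<close> (see \<open>unitary_totient_exact_prime_powers\<close> below). The truncated subtraction is harmless,
  since each of them is at least 2. As \<open>prime_factors 0 = {}\<close>, the value at 0 is 1.
\<close>

definition unitary_totient :: "nat \<Rightarrow> nat" where
  "unitary_totient N = (\<Prod>p\<in>prime_factors N. p ^ multiplicity p N - 1)"

lemma unitary_totient_1: "unitary_totient 1 = 1"
  by (simp add: unitary_totient_def)

lemma unitary_totient_exact_prime_powers:
  assumes "N > 0"
  shows "unitary_totient N =
    (\<Prod>(p, e)\<in>{(p, e). prime p \<and> e \<ge> 1 \<and> p ^ e dvd N \<and> \<not> p ^ (e + 1) dvd N}. p ^ e - 1)"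
proof -
  have exact: "e = multiplicity p N"
    if "prime p" "p ^ e dvd N" "\<not> p ^ (e + 1) dvd N" for p e
    using that by (intro multiplicity_eqI [symmetric]) auto
  have "{(p, e). prime p \<and> e \<ge> 1 \<and> p ^ e dvd N \<and> \<not> p ^ (e + 1) dvd N} =
        (\<lambda>p. (p, multiplicity p N)) ` prime_factors N" (is "?L = ?R")
  proof
    show "?L \<subseteq> ?R"
    proof
      fix x assume "x \<in> ?L"
      then obtain p e where x: "x = (p, e)" "prime p" "e \<ge> 1" "p ^ e dvd N" "\<not> p ^ (e + 1) dvd N"
        by auto
      have "p dvd N"
        using x by (meson dvd_power dvd_trans less_le_trans zero_less_one)
      then have "p \<in> prime_factors N"
        using x assms by (simp add: prime_factors_dvd)
      then show "x \<in> ?R"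
        using x exact by auto
    qed
    show "?R \<subseteq> ?L"
    proof
      fix x assume "x \<in> ?R"
      then obtain p where x: "x = (p, multiplicity p N)" "p \<in> prime_factors N" by auto
      then have "prime p" "multiplicity p N > 0"
        by (auto simp: prime_factors_multiplicity)
      moreover have "\<not> p ^ (multiplicity p N + 1) dvd N"
        using assms \<open>prime p\<close> power_dvd_iff_le_multiplicity [of N p "multiplicity p N + 1"]
        by (metis Suc_eq_plus1 neq0_conv not_less_eq_eq not_prime_unit order_refl)
      ultimately show "x \<in> ?L"
        using x by (auto simp: multiplicity_dvd)
    qed
  qed
  then show ?thesis
    by (simp add: unitary_totient_def prod.reindex inj_on_def)
qed

end

(*
  Let S be the set of prime powers q exactly dividing N and k = N / phi*(N), so that the product of all
  q / (q - 1) with q in S is k, where k <= 8 if there are at most seven of them. Fixing the elements of S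
  one by one in increasing order, the product A / B of the remaining q / (q - 1) confines the next q to
  an interval, and the reduced numerator A must divide the product of the remaining q: its primes have to
  occur among them and cannot divide the q already fixed. The resulting search tree has about a thousand
  nodes. Only the branch 3, 5, 17, 257 has an interval that is too long. There N = 65535 * 2^a * X * Y
  with prime powers X < Y; comparing the factorizations of X - 1, Y - 1 and 2^a - 1 gives 2^a - 1 =
  F * g * h with F dividing 65535, g dividing X and h dividing Y, bounds a, and leaves finitely many
  cases that are settled by the factors of 2^a - 1.
*)
theory Submission
  imports Defs "HOL-Number_Theory.Number_Theory"
begin

section \<open>Modulo by binary long division\<close>

text \<open>The cost of evaluation shapes everything: each search is run by
  \<open>code_simp\<close>, that is, by rewriting. The exceptional branch comes from 65535 = 2^16 -
  1 being the product of the Fermat primes 3, 5, 17, 257: for k = 2 the remaining ratio is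
  65536/65535, so close to 1 that the least of three remaining prime powers may lie anywhere from
  65536 to almost 3 * 65536. With two left, the single prime 2 of the numerator makes q a power of 2
  or forces q - 1 to be a divisor of 65535 times a power of 2; with three left it gives no such
  restriction. Since elements are fixed in increasing order, a large power of 2 comes late, so 2^a
  is still open there. What makes this branch finite is that, with a = 16 + n, the odd parts of (X -
  1)/D and (Y - 1)/E solve a linear system whose determinant times F is 2^n - 1 up to sign.\<close>

datatype comparison = Less | Equal | Greater num

fun double_diff :: "comparison \<Rightarrow> comparison" where
  "double_diff Less = Less"
| "double_diff Equal = Equal"
| "double_diff (Greater d) = Greater (num.Bit0 d)"

fun double_inc_diff :: "comparison \<Rightarrow> comparison" where
  "double_inc_diff Less = Less"
| "double_inc_diff Equal = Greater num.One"
| "double_inc_diff (Greater d) = Greater (num.Bit1 d)"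

fun double_dec_diff :: "comparison \<Rightarrow> comparison" where
  "double_dec_diff Less = Less"
| "double_dec_diff Equal = Less"
| "double_dec_diff (Greater d) = Greater (Num.BitM d)"

fun num_diff :: "num \<Rightarrow> num \<Rightarrow> comparison" where
  "num_diff num.One num.One = Equal"
| "num_diff num.One (num.Bit0 b) = Less"
| "num_diff num.One (num.Bit1 b) = Less"
| "num_diff (num.Bit0 a) num.One = Greater (Num.BitM a)"
| "num_diff (num.Bit1 a) num.One = Greater (num.Bit0 a)"
| "num_diff (num.Bit0 a) (num.Bit0 b) = double_diff (num_diff a b)"
| "num_diff (num.Bit1 a) (num.Bit1 b) = double_diff (num_diff a b)"
| "num_diff (num.Bit1 a) (num.Bit0 b) = double_inc_diff (num_diff a b)"
| "num_diff (num.Bit0 a) (num.Bit1 b) = double_dec_diff (num_diff a b)"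

text \<open>Since \<open>num\<close> has no zero, a remainder 0 is \<open>None\<close>, and a
  comparison carries the difference only when it is positive. Comparison and subtraction are thus
  done in a single pass over the digits.\<close>

fun reduce :: "num \<Rightarrow> comparison \<Rightarrow> num option" where
  "reduce a Less = Some a"
| "reduce a Equal = None"
| "reduce a (Greater d) = Some d"

fun rem_bit0 :: "num option \<Rightarrow> num \<Rightarrow> num option" where
  "rem_bit0 None b = None"
| "rem_bit0 (Some r) b = reduce (num.Bit0 r) (num_diff (num.Bit0 r) b)"

fun rem_bit1 :: "num option \<Rightarrow> num \<Rightarrow> num option" where
  "rem_bit1 None b = reduce num.One (num_diff num.One b)"
| "rem_bit1 (Some r) b = reduce (num.Bit1 r) (num_diff (num.Bit1 r) b)"

fun num_rem :: "num \<Rightarrow> num \<Rightarrow> num option" where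
  "num_rem num.One b = rem_bit1 None b"
| "num_rem (num.Bit0 a) b = rem_bit0 (num_rem a b) b"
| "num_rem (num.Bit1 a) b = rem_bit1 (num_rem a b) b"

fun int_of_rem :: "num option \<Rightarrow> int" where
  "int_of_rem None = 0"
| "int_of_rem (Some r) = Int.Pos r"

lemma num_diff:
  "case num_diff a b of Less \<Rightarrow> (numeral a :: int) < numeral b | Equal \<Rightarrow> (numeral a :: int) = numeral b
   | Greater d \<Rightarrow> (numeral a :: int) = numeral b + numeral d"
proof (induction a b rule: num_diff.induct)
  case (6 a b)
  then show ?case by (cases "num_diff a b") auto
next
  case (7 a b)
  then show ?case by (cases "num_diff a b") auto
next
  case (8 a b)
  then show ?case by (cases "num_diff a b") auto
next
  case (9 a b)
  show ?case
  proof (cases "num_diff a b")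
    case (Greater d)
    have "(numeral a :: int) = numeral b + numeral d"
      using 9 unfolding Greater by (simp only: comparison.case)
    then show ?thesis
      unfolding num_diff.simps Greater double_dec_diff.simps comparison.case numeral_Bit0 numeral_Bit1 numeral_BitM
      by (simp only: algebra_simps)
  qed (use 9 in auto)
next
  case (4 a)
  show ?case
    unfolding num_diff.simps comparison.case numeral_BitM by (simp only: numeral_One algebra_simps)
qed auto

text \<open>Appending a digit to a remainder r < b gives at most 2 * r + 1 < 2 * b, so one
  subtraction always suffices.\<close>

lemma int_of_reduce:
  assumes "(numeral a :: int) < 2 * numeral b"
  shows "int_of_rem (reduce a (num_diff a b)) = numeral a mod numeral b"
proof (cases "num_diff a b")
  case Less
  have "(numeral a :: int) mod numeral b = numeral a"
    using num_diff[of a b] Less by (intro mod_pos_pos_trivial) simp_all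
  then show ?thesis
    by (simp only: Less reduce.simps int_of_rem.simps Int.Pos_def)
next
  case Equal
  then show ?thesis
    using num_diff[of a b] by simp
next
  case (Greater d)
  have "(numeral a :: int) = numeral b + numeral d"
    using num_diff[of a b] unfolding Greater by (simp only: comparison.case)
  then have *: "(numeral a :: int) = numeral d + numeral b"
    by linarith
  have "(numeral d :: int) + numeral b < numeral b + numeral b"
    using assms unfolding * mult_2 .
  then have "(numeral d :: int) mod numeral b = numeral d"
    by (intro mod_pos_pos_trivial zero_le_numeral) (rule add_less_imp_less_right)
  then show ?thesis
    by (simp only: Greater reduce.simps int_of_rem.simps Int.Pos_def * mod_add_self2)
qed

lemma int_of_num_rem: "int_of_rem (num_rem a b) = (numeral a :: int) mod numeral b"
proof (induction a)
  case One
  have "(numeral num.One :: int) < 2 * numeral b"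
    by (simp add: less_le_trans[of 1 2])
  then show ?case
    by (simp only: num_rem.simps rem_bit1.simps int_of_reduce)
next
  case (Bit0 a)
  have eq: "(numeral (num.Bit0 a) :: int) mod numeral b = (2 * int_of_rem (num_rem a b)) mod numeral b"
    unfolding Bit0 by (simp only: numeral_Bit0[of a] mult_2[symmetric] mod_mult_right_eq)
  show ?case
  proof (cases "num_rem a b")
    case None
    then show ?thesis
      unfolding eq by simp
  next
    case (Some r)
    then have r: "int_of_rem (num_rem a b) = numeral r"
      by simp
    have "(numeral r :: int) < numeral b"
      using Bit0 r pos_mod_bound[of "numeral b :: int" "numeral a"] by (simp del: numeral_mod_numeral)
    then have "(numeral (num.Bit0 r) :: int) < 2 * numeral b"
      unfolding numeral_Bit0[of r] by linarith
    then show ?thesis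
      unfolding eq num_rem.simps Some rem_bit0.simps int_of_reduce[OF \<open>numeral (num.Bit0 r) < _\<close>]
      by (simp only: numeral_Bit0[of r] mult_2 int_of_rem.simps Int.Pos_def)
  qed
next
  case (Bit1 a)
  have eq: "(numeral (num.Bit1 a) :: int) mod numeral b = (2 * int_of_rem (num_rem a b) + 1) mod numeral b"
    unfolding Bit1 numeral_Bit1[of a] mult_2[symmetric] by (metis mod_add_left_eq mod_mult_right_eq)
  show ?case
  proof (cases "num_rem a b")
    case None
    have "(numeral num.One :: int) < 2 * numeral b"
      by (simp add: less_le_trans[of 1 2])
    then show ?thesis
      unfolding eq unfolding num_rem.simps None rem_bit1.simps
      by (subst int_of_reduce) simp_all
  next
    case (Some r)
    then have r: "int_of_rem (num_rem a b) = numeral r"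
      by simp
    have "(numeral r :: int) < numeral b"
      using Bit1 r pos_mod_bound[of "numeral b :: int" "numeral a"] by (simp del: numeral_mod_numeral)
    then have "(numeral (num.Bit1 r) :: int) < 2 * numeral b"
      unfolding numeral_Bit1[of r] by linarith
    then show ?thesis
      unfolding eq num_rem.simps Some rem_bit1.simps int_of_reduce[OF \<open>numeral (num.Bit1 r) < _\<close>]
      by (simp only: numeral_Bit1[of r] mult_2 int_of_rem.simps Int.Pos_def)
  qed
qed

text \<open>
  This replaces the generic code equation for \<open>mod\<close>, which rewriting executes about four times
  more slowly. The search below spends most of its time in this operation.
\<close>

lemma mod_Pos_code [code]: "Int.Pos a mod Int.Pos b = int_of_rem (num_rem a b)"
  by (simp add: int_of_num_rem)

section \<open>Prime powers with a prescribed product of ratios\<close>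

lemma card_le_Max_minus:
  fixes S :: "int set"
  assumes "finite S" "S \<noteq> {}" "\<And>q. q \<in> S \<Longrightarrow> lo \<le> q"
  shows "lo + int (card S) \<le> Max S + 1"
proof -
  have "S \<subseteq> {lo..Max S}"
    using assms by auto
  then have "card S \<le> card {lo..Max S}"
    by (intro card_mono) auto
  moreover have "lo \<le> Max S"
    using assms by simp
  ultimately show ?thesis
    by simp
qed

text \<open>In increasing order the elements are at least lo, lo + 1, ..., and x / (x - 1)
  decreases; the product of lo / (lo - 1), (lo + 1) / lo, ... telescopes. The induction removes the
  maximum because \<open>card_le_Max_minus\<close> bounds it from below.\<close>

lemma prod_telescope_le:
  fixes S :: "int set"
  assumes "finite S" "\<And>q. q \<in> S \<Longrightarrow> lo \<le> q" "1 < lo"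
  shows "\<Prod>S * (lo - 1) \<le> (\<Prod>q\<in>S. q - 1) * (lo - 1 + int (card S))"
  using assms(1,2)
proof (induction "card S" arbitrary: S)
  case 0
  then show ?case by simp
next
  case (Suc n)
  define M where "M = Max S"
  define T where "T = S - {M}"
  have "S \<noteq> {}"
    using Suc by auto
  then have M: "M \<in> S"
    using Suc by (simp add: M_def)
  have T: "finite T" "S = insert M T" "M \<notin> T" "card T = n"
    using Suc M by (auto simp: T_def)
  have IH: "\<Prod>T * (lo - 1) \<le> (\<Prod>q\<in>T. q - 1) * (lo - 1 + int n)"
    using Suc.hyps(1)[of T] Suc.prems T by auto
  have "lo + int (card S) \<le> M + 1"
    unfolding M_def using Suc \<open>S \<noteq> {}\<close> by (intro card_le_Max_minus) auto
  then have le: "lo + int n \<le> M"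
    using Suc by simp
  have nn: "0 \<le> (\<Prod>q\<in>T. q - 1)"
    using Suc.prems T assms(3) by (intro prod_nonneg) force
  have "\<Prod>S * (lo - 1) = M * (\<Prod>T * (lo - 1))"
    using T by simp
  also have "\<dots> \<le> M * ((\<Prod>q\<in>T. q - 1) * (lo - 1 + int n))"
    using IH le assms(3) by (intro mult_left_mono) auto
  also have "\<dots> = (\<Prod>q\<in>T. q - 1) * (M * (lo - 1 + int n))"
    by simp
  \<comment> \<open>This is M / (M - 1) \<le> (lo + n) / (lo + n - 1) with denominators cleared,
    which is equivalent to lo + n \<le> M.\<close>
  also have "\<dots> \<le> (\<Prod>q\<in>T. q - 1) * ((M - 1) * (lo + int n))"
    using le nn by (intro mult_left_mono) (auto simp: algebra_simps)
  also have "\<dots> = (\<Prod>q\<in>S. q - 1) * (lo - 1 + int (card S))"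
    using T by (simp add: algebra_simps)
  finally show ?case .
qed

text \<open>
  The set \<open>S\<close> consists of the exact prime powers of \<open>N\<close> that a search has not fixed yet: \<open>Q\<close> is the
  product of the fixed ones, \<open>m\<close> bounds the number of the others, and \<open>A / B\<close> in lowest terms is what
  remains of \<open>N / \<phi>\<^sup>*(N)\<close>. Since \<open>A\<close> divides the product of \<open>S\<close>, its prime factors are bases of
  elements of \<open>S\<close>, and it is coprime to \<open>Q\<close>.
\<close>

definition tail_system :: "int set \<Rightarrow> nat \<Rightarrow> int \<Rightarrow> int \<Rightarrow> int \<Rightarrow> int \<Rightarrow> bool" where
  "tail_system S m Q A B lo \<longleftrightarrow>
     finite S \<and> card S \<le> m \<and> 0 < A \<and> 0 < B \<and> coprime A B \<and> 1 < lo \<and>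
     (\<forall>q\<in>S. primepow q \<and> lo \<le> q \<and> coprime q Q) \<and> pairwise coprime S \<and>
     B * \<Prod>S = A * (\<Prod>q\<in>S. q - 1)"

lemma tail_system_pos:
  assumes "tail_system S m Q A B lo" "q \<in> S"
  shows "1 < q"
  using assms by (force simp: tail_system_def)

lemma tail_system_dvd_prod:
  assumes "tail_system S m Q A B lo"
  shows "A dvd \<Prod>S"
proof -
  have "A dvd B * \<Prod>S" "coprime A B"
    using assms by (auto simp: tail_system_def)
  then show ?thesis
    by (simp add: coprime_dvd_mult_right_iff)
qed

lemma tail_system_coprime:
  assumes "tail_system S m Q A B lo"
  shows "coprime A Q"
proof -
  have "coprime (\<Prod>S) Q"
    using assms by (intro prod_coprime_left) (auto simp: tail_system_def)
  then show ?thesis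
    using tail_system_dvd_prod[OF assms] by (meson coprime_divisors dvd_refl)
qed

lemma tail_system_prod_pos:
  assumes "tail_system S m Q A B lo"
  shows "0 < \<Prod>S" "0 < (\<Prod>q\<in>S. q - 1)" "(\<Prod>q\<in>S. q - 1) \<le> \<Prod>S"
    "S \<noteq> {} \<Longrightarrow> (\<Prod>q\<in>S. q - 1) < \<Prod>S"
proof -
  show "0 < \<Prod>S" "0 < (\<Prod>q\<in>S. q - 1)"
    using tail_system_pos[OF assms] by (force intro: prod_pos)+
  show "(\<Prod>q\<in>S. q - 1) \<le> \<Prod>S"
    using tail_system_pos[OF assms] by (intro prod_mono) force
  show "(\<Prod>q\<in>S. q - 1) < \<Prod>S" if "S \<noteq> {}"
  proof -
    obtain i where "i \<in> S"
      using \<open>S \<noteq> {}\<close> by auto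
    then show ?thesis
      using tail_system_pos[OF assms] assms
      by (intro prod_mono_strict[of i]) (force simp: tail_system_def)+
  qed
qed

lemma tail_system_le:
  assumes "tail_system S m Q A B lo"
  shows "A * (lo - 1) \<le> B * (lo - 1 + int m)"
proof -
  note pos = tail_system_prod_pos[OF assms]
  have eq: "B * \<Prod>S = A * (\<Prod>q\<in>S. q - 1)" and "0 < B" "card S \<le> m"
    using assms by (auto simp: tail_system_def)
  have "\<Prod>S * (lo - 1) \<le> (\<Prod>q\<in>S. q - 1) * (lo - 1 + int (card S))"
    using assms by (intro prod_telescope_le) (auto simp: tail_system_def)
  also have "\<dots> \<le> (\<Prod>q\<in>S. q - 1) * (lo - 1 + int m)"
    using pos \<open>card S \<le> m\<close> by (intro mult_left_mono) auto
  finally have "B * (\<Prod>S * (lo - 1)) \<le> B * ((\<Prod>q\<in>S. q - 1) * (lo - 1 + int m))"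
    using \<open>0 < B\<close> by simp
  moreover have "B * (\<Prod>S * (lo - 1)) = (\<Prod>q\<in>S. q - 1) * (A * (lo - 1))"
    using eq by (metis mult.assoc mult.commute)
  ultimately have "(\<Prod>q\<in>S. q - 1) * (A * (lo - 1)) \<le> (\<Prod>q\<in>S. q - 1) * (B * (lo - 1 + int m))"
    by (simp add: mult.left_commute)
  then show ?thesis
    using pos(2) by simp
qed

lemma tail_system_empty_iff:
  assumes "tail_system S m Q A B lo"
  shows "B \<le> A" "A = B \<longleftrightarrow> S = {}"
proof -
  note pos = tail_system_prod_pos[OF assms]
  have eq: "B * \<Prod>S = A * (\<Prod>q\<in>S. q - 1)" and AB: "0 < B" "0 < A"
    using assms by (auto simp: tail_system_def)
  show "B \<le> A"
  proof (rule ccontr)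
    assume "\<not> B \<le> A"
    then have "A * (\<Prod>q\<in>S. q - 1) < B * \<Prod>S"
      using pos AB by (intro mult_less_le_imp_less) auto
    with eq show False by simp
  qed
  show "A = B \<longleftrightarrow> S = {}"
  proof
    assume "A = B"
    then have "\<Prod>S = (\<Prod>q\<in>S. q - 1)"
      using eq AB by simp
    then show "S = {}"
      using pos(4) by force
  qed (use eq in simp)
qed

lemma tail_system_step:
  fixes Q A B lo q :: int
  defines "d \<equiv> gcd (A * (q - 1)) (B * q)"
  assumes sys: "tail_system S (Suc m) Q A B lo" and q: "q \<in> S" "\<And>r. r \<in> S \<Longrightarrow> q \<le> r"
  shows "tail_system (S - {q}) m (Q * q) (A * (q - 1) div d) (B * q div d) (q + 1)"
proof -
  have fin: "finite S" and card: "card S \<le> Suc m" and AB: "0 < A" "0 < B"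
    and pw: "pairwise coprime S" and eq: "B * \<Prod>S = A * (\<Prod>q\<in>S. q - 1)"
    and el: "\<And>q. q \<in> S \<Longrightarrow> primepow q \<and> lo \<le> q \<and> coprime q Q" and "1 < lo"
    using sys by (auto simp: tail_system_def)
  have "1 < q"
    using el[OF q(1)] \<open>1 < lo\<close> by simp
  have d: "0 < d" "d dvd A * (q - 1)" "d dvd B * q"
    using AB \<open>1 < q\<close> by (auto simp: d_def)
  have "\<Prod>S = q * \<Prod>(S - {q})" "(\<Prod>q\<in>S. q - 1) = (q - 1) * (\<Prod>q\<in>S - {q}. q - 1)"
    using fin q(1) by (simp_all add: prod.remove)
  then have eq': "(B * q) * \<Prod>(S - {q}) = (A * (q - 1)) * (\<Prod>q\<in>S - {q}. q - 1)"
    using eq by (simp add: mult.assoc)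
  have "d * ((B * q div d) * \<Prod>(S - {q})) = d * ((A * (q - 1) div d) * (\<Prod>q\<in>S - {q}. q - 1))"
    unfolding mult.assoc[symmetric] dvd_mult_div_cancel[OF d(2)] dvd_mult_div_cancel[OF d(3)]
    by (rule eq')
  then have "(B * q div d) * \<Prod>(S - {q}) = (A * (q - 1) div d) * (\<Prod>q\<in>S - {q}. q - 1)"
    using d(1) by simp
  moreover have "coprime (A * (q - 1) div d) (B * q div d)"
    unfolding d_def using AB \<open>1 < q\<close> by (intro div_gcd_coprime) auto
  moreover have "0 < A * (q - 1) div d" "0 < B * q div d"
    using AB \<open>1 < q\<close> d by (auto simp: pos_imp_zdiv_pos_iff zdvd_imp_le)
  moreover have "\<forall>r\<in>S - {q}. primepow r \<and> q + 1 \<le> r \<and> coprime r (Q * q)"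
    using el q pw by (fastforce simp: pairwise_def coprime_commute)
  moreover have "pairwise coprime (S - {q})" "card (S - {q}) \<le> m"
    using fin card q(1) pw by (auto intro: pairwise_subset)
  ultimately show ?thesis
    unfolding tail_system_def using fin \<open>1 < q\<close> by simp
qed

text \<open>The ratio left after q is at least 1, so q / (q - 1) \<le> A / B. The other bound is
  \<open>tail_system_le\<close> with the least element q itself in place of lo.\<close>

lemma tail_system_next_bounds:
  assumes sys: "tail_system S (Suc m) Q A B lo" and q: "q \<in> S" "\<And>r. r \<in> S \<Longrightarrow> q \<le> r"
  shows "A \<le> q * (A - B)" "q * (A - B) \<le> A + int m * B"
proof -
  have "1 < q"
    using tail_system_pos[OF sys q(1)] .
  define d where "d = gcd (A * (q - 1)) (B * q)"
  have d: "0 \<le> d" "d dvd A * (q - 1)" "d dvd B * q"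
    by (auto simp: d_def)
  have "B * q div d \<le> A * (q - 1) div d"
    using tail_system_empty_iff(1)[OF tail_system_step[OF sys q]] unfolding d_def .
  then have "d * (B * q div d) \<le> d * (A * (q - 1) div d)"
    using d(1) by (intro mult_left_mono)
  then have "B * q \<le> A * (q - 1)"
    using d by simp
  then show "A \<le> q * (A - B)"
    by (simp add: algebra_simps)
  have "tail_system S (Suc m) Q A B q"
    using sys q \<open>1 < q\<close> by (auto simp: tail_system_def)
  from tail_system_le[OF this] show "q * (A - B) \<le> A + int m * B"
    by (simp add: algebra_simps)
qed

lemma tail_system_mono:
  assumes "tail_system S m Q A B lo" "card S \<le> m'" "1 < lo'" "lo' \<le> lo"
  shows "tail_system S m' Q A B lo'"
  using assms by (auto simp: tail_system_def)

section \<open>The search\<close>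

function prime_factor_list :: "int \<Rightarrow> int \<Rightarrow> int list" where
  "prime_factor_list d n = (if n < d * d then (if n \<le> 1 then [] else [n])
     else if d < 2 then []
     else if n mod d = 0 then d # prime_factor_list d (n div d)
     else prime_factor_list (if d = 2 then 3 else d + 2) n)"
  by auto
termination
proof (relation "measures [\<lambda>(d, n). nat n, \<lambda>(d, n). nat (n - d)]", goal_cases)
  case 1 show ?case by simp
next
  case (2 d n)
  then have "0 < d * d" by (simp add: zero_less_mult_iff)
  with 2 have "0 < n" by linarith
  with 2 have "n div d < n" by (simp add: int_div_less_self)
  with \<open>0 < n\<close> show ?case by simp
next
  case (3 d n)
  then have "d < d * d" by simp
  with 3 have "d < n" by linarith
  then show ?case by simp
qed
declare prime_factor_list.simps [simp del]

text \<open>Working on the binary numeral removes all factors 2 without a division.\<close>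

fun odd_num :: "num \<Rightarrow> num" where
  "odd_num num.One = num.One"
| "odd_num (num.Bit0 n) = odd_num n"
| "odd_num (num.Bit1 n) = num.Bit1 n"

definition odd_part :: "int \<Rightarrow> int" where
  "odd_part n = (if 0 < n then numeral (odd_num (num_of_nat (nat n))) else n)"

lemma odd_part_code [code]:
  "odd_part 0 = 0" "odd_part (Int.Pos k) = Int.Pos (odd_num k)" "odd_part (Int.Neg k) = Int.Neg k"
  by (simp_all add: odd_part_def num_of_nat_numeral_eq)

text \<open>
  The argument \<open>b\<close> is a budget: trial division stops as soon as more than \<open>b\<close> primes must occur, and the
  last element of the result may then be composite.
\<close>

function odd_primes :: "int \<Rightarrow> int \<Rightarrow> int \<Rightarrow> int list" where
  "odd_primes b d n = (if n \<le> 1 then [] else if b < 1 then [n] else if n < d * d then [n] else if d < 2 then []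
     else if n mod d = 0 then
       if n div d mod d = 0 then odd_primes b d (n div d) else d # odd_primes (b - 1) (d + 2) (n div d)
     else odd_primes b (d + 2) n)"
  by auto
termination
proof (relation "measures [\<lambda>(b, d, n). nat n, \<lambda>(b, d, n). nat (n - d)]", goal_cases)
  case 1 show ?case by simp
next
  case (2 b d n)
  then have "n div d < n" by (simp add: int_div_less_self)
  with 2 show ?case by simp
next
  case (3 b d n)
  then have "n div d < n" by (simp add: int_div_less_self)
  with 3 show ?case by simp
next
  case (4 b d n)
  then have "d < d * d" by simp
  with 4 have "d < n" by linarith
  then show ?case by simp
qed
declare odd_primes.simps [simp del]

definition distinct_primes1 where
  "distinct_primes1 b n m = (if m = n then odd_primes b 3 n else 2 # odd_primes (b - 1) 3 m)"
definition distinct_primes where "distinct_primes b n = distinct_primes1 b n (odd_part n)"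

text \<open>The counter only limits the work: when it runs out the answer is False, which merely
  forgoes pruning.\<close>

fun has_cofactor :: "nat \<Rightarrow> int \<Rightarrow> int \<Rightarrow> bool" where
  "has_cofactor 0 p q = False"
| "has_cofactor (Suc n) p q = (if q mod p = 0 then has_cofactor n p (q div p) else q \<noteq> 1)"

primrec mixed :: "int list \<Rightarrow> int \<Rightarrow> bool" where
  "mixed [] q = False"
| "mixed (p # ps) q = (if q mod p = 0 then has_cofactor 12 p q else mixed ps q)"

primrec some_dvd :: "int list \<Rightarrow> int \<Rightarrow> bool" where
  "some_dvd [] q = False"
| "some_dvd (p # ps) q = (if q mod p = 0 then True else some_dvd ps q)"

primrec list_mem :: "int list \<Rightarrow> int \<Rightarrow> bool" where
  "list_mem [] q = False"
| "list_mem (p # ps) q = (if q = p then True else list_mem ps q)"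

definition solutions :: "int list" where
  "solutions = [1, 2, 6, 12, 168, 240, 14880, 65280, 7608944640, 65535*65536, 65535*131071*131072,65535*65537*2^32]"

text \<open>Soundness holds for every list of primes; this choice balances pruning against cost.\<close>

definition small_primes :: "int list" where "small_primes = [3,5,7,11,13,17,19,23,29]"

text \<open>Here p is a prime power already fixed and r = q mod p. If p divides q, coprimality
  fails. If p divides q - 1, it enters the numerator A * (q - 1), whose reduced form must stay
  coprime to every fixed element; q is coprime to p, so only B can cancel it.\<close>

definition conflict1 :: "int \<Rightarrow> int \<Rightarrow> int \<Rightarrow> int \<Rightarrow> (int \<Rightarrow> bool) \<Rightarrow> bool" where
  "conflict1 r p B q f = (if r = 0 then True else if r = 1 then if B mod p = 0 then f q else True else f q)"

primrec conflict :: "int list \<Rightarrow> int \<Rightarrow> int \<Rightarrow> bool" where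
  "conflict [] B q = False"
| "conflict (p # ps) B q = conflict1 (q mod p) p B q (conflict ps B)"

text \<open>
  The functions are split so that all arguments are evaluated before a body is unfolded, and they avoid
  abstractions, because \<open>code_simp\<close> rewrites under binders.
\<close>

definition extend3 where "extend3 f L Q A B lo = (if gcd A Q = (1::int) then f L Q A B (lo::int) else True)"
definition extend2 where "extend2 f L Q A B d lo = extend3 f L Q (A div d) (B div d) lo"
definition extend where
  "extend f L Q A B q =
     (if conflict L B q then True else if mixed small_primes q then True else
       extend2 f (q # L) (Q * q) (A * (q - 1)) (B * q) (gcd (A * (q - 1)) (B * q)) (q + 1))"
definition extend_new where "extend_new f L F Q A B q = (if some_dvd F q then True else extend f L Q A B q)"

function check_range :: "int \<Rightarrow> (int \<Rightarrow> bool) \<Rightarrow> int \<Rightarrow> int \<Rightarrow> bool" where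
  "check_range s P q hi = (if hi < q then True else if s < 1 then False else if P q then check_range s P (q + s) hi else False)"
  by auto
termination by (relation "measure (\<lambda>(s, P, q, hi). nat (hi + 1 - q))") auto
declare check_range.simps [simp del]

function check_powers :: "int \<Rightarrow> (int \<Rightarrow> bool) \<Rightarrow> int \<Rightarrow> int \<Rightarrow> int \<Rightarrow> bool" where
  "check_powers p P lo hi x = (if hi < x then True else if x < 1 then False else if p < 2 then False else
     if x < lo then check_powers p P lo hi (x * p) else if P x then check_powers p P lo hi (x * p) else False)"
  by auto
termination by (relation "measure (\<lambda>(p, P, lo, hi, x). nat (hi + 1 - x))") auto
declare check_powers.simps [simp del]

primrec check_all_powers where
  "check_all_powers [] P lo hi = True"
| "check_all_powers (p # ps) P lo hi = (if check_powers p P lo hi p then check_all_powers ps P lo hi else False)"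

definition check_succ where "check_succ P lo c = (if c + 1 < lo then True else P (c + 1))"

function check_smooth :: "int list \<Rightarrow> (int \<Rightarrow> bool) \<Rightarrow> int \<Rightarrow> int \<Rightarrow> bool" where
  "check_smooth [] P hi x = (if hi < x then True else P x)"
| "check_smooth (p # ps) P hi x = (if hi < x then True else if x < 1 then False else if p < 2 then False
     else if check_smooth ps P hi x then check_smooth (p # ps) P hi (x * p) else False)"
  by pat_completeness auto
termination by (relation "measures [\<lambda>(ps, P, hi, x). length ps, \<lambda>(ps, P, hi, x). nat (hi + 1 - x)]") auto
declare check_smooth.simps [simp del]

primrec check_divisors :: "int list \<Rightarrow> (int \<Rightarrow> bool) \<Rightarrow> int \<Rightarrow> bool" where
  "check_divisors [] P x = P x"
| "check_divisors (p # ps) P x = (if check_divisors ps P x then check_divisors ps P (x * p) else False)"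

text \<open>There are m + 1 elements left, each a power of one prime, and n primes of A to be placed
  among them. For n = m + 1 the next q must be a power of one of these primes. For n = m a q that is
  not such a power leaves all n primes to the other m elements, and then q - 1 is a divisor of B
  times a number smooth over F; the threshold 10 only decides when this enumeration is cheaper than
  a scan. For n < m, if 2 is among the primes, a q that is not a power of 2 is odd.\<close>

definition expand3 where
  "expand3 m F P S B lo hi n =
     (if m + 1 < n then True
      else if check_all_powers F P lo hi then
        if m < n then True
        else if n = m then if lo + 10 < hi
          then check_divisors (prime_factor_list 2 B) (check_smooth F (check_succ P lo) (hi - 1)) 1
          else check_range 1 S lo hi
        else if list_mem F 2 then check_range 2 S (lo + (if lo mod 2 = 0 then 1 else 0)) hi else check_range 1 S lo hi else False)"
definition expand2 where "expand2 f m L Q A B F lo hi =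
  expand3 m F (extend f L Q A B) (extend_new f L F Q A B) B lo hi (int (length F))"
definition expand1 where "expand1 f m L Q A B lo hi =
  (if hi < lo then True else expand2 f m L Q A B (distinct_primes (m + 1) A) lo hi)"
text \<open>The first quotient is the ceiling of A / (A - B), the second the floor of the upper
  bound in \<open>tail_system_next_bounds\<close>.\<close>

definition expand where
  "expand f m L Q A B lo = expand1 f m L Q A B (max lo ((2 * A - B - 1) div (A - B))) ((A + m * B) div (A - B))"

text \<open>True means that every completion of the branch is listed in \<open>solutions\<close>, so
  a refuted branch yields True as well. The strict inequality contradicts the telescoping bound for
  m + 1 elements. A single remaining q has q / (q - 1) = A / B in lowest terms, whence q = A = B +
  1.\<close>

primrec search :: "nat \<Rightarrow> int list \<Rightarrow> int \<Rightarrow> int \<Rightarrow> int \<Rightarrow> int \<Rightarrow> bool" where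
  "search 0 L Q A B lo = (if A = B then list_mem solutions Q else True)"
| "search (Suc m) L Q A B lo =
    (if A = B then list_mem solutions Q else if A < B then True
     else if B * (lo + int m) < A * (lo - 1) then True
     else if m = 0 then if A = B + 1 then if mixed small_primes A then True else list_mem solutions (Q * A) else True
     else if Q = 65535 \<and> A = 65536 \<and> B = 65535 \<and> m = 2 then True
     else expand (search m) (int m) L Q A B lo)"


section \<open>Correctness of the factoring routines and of the pruning tests\<close>

lemma prime_if_less_square:
  fixes d n :: int
  assumes "1 < n" "n < d * d" "0 < d" "\<And>p. prime p \<Longrightarrow> p dvd n \<Longrightarrow> d \<le> p"
  shows "prime n"
proof -
  obtain p where p: "prime p" "p dvd n"
    using prime_divisor_exists[of n] assms(1) by auto
  then obtain k where k: "n = p * k"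
    by (elim dvdE)
  have "k = 1"
  proof (rule ccontr)
    assume "k \<noteq> 1"
    moreover have "0 < k"
      using k assms(1) prime_gt_0_int[OF p(1)] zero_less_mult_pos[of p k] by linarith
    ultimately obtain r where r: "prime r" "r dvd k"
      using prime_divisor_exists[of k] by auto
    then have "d \<le> r" "r \<le> k"
      using assms(4)[of r] k \<open>0 < k\<close> by (auto intro: zdvd_imp_le)
    moreover have "d \<le> p"
      using assms(4) p by auto
    ultimately have "d * d \<le> p * k"
      using assms(3) by (intro mult_mono) auto
    with assms(2) k show False by simp
  qed
  then show ?thesis
    using p k by simp
qed

lemma prime_if_least:
  fixes d n :: int
  assumes "1 < d" "d dvd n" "\<And>p. prime p \<Longrightarrow> p dvd n \<Longrightarrow> d \<le> p"
  shows "prime d"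
proof -
  obtain r where r: "prime r" "r dvd d"
    using prime_divisor_exists[of d] assms by auto
  have "d \<le> r"
    using r assms by (intro assms(3)) (auto intro: dvd_trans)
  moreover have "r \<le> d"
    using r assms by (intro zdvd_imp_le) auto
  ultimately show ?thesis
    using r by simp
qed

lemma prod_prime_factor_list:
  fixes d n :: int
  assumes "d = 2 \<or> odd d" "1 < d" "0 < n" "\<And>p. prime p \<Longrightarrow> p dvd n \<Longrightarrow> d \<le> p"
  shows "prod_list (prime_factor_list d n) = n \<and> (\<forall>p\<in>set (prime_factor_list d n). prime p)"
  using assms
proof (induction d n rule: prime_factor_list.induct)
  case (1 d n)
  note ge = "1.prems"(4)
  consider "n < d * d" "n \<le> 1" | "n < d * d" "1 < n" | "d * d \<le> n" "n mod d = 0" | "d * d \<le> n" "n mod d \<noteq> 0"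
    by linarith
  then show ?case
  proof cases
    case 1
    then show ?thesis
      using "1.prems" by (simp add: prime_factor_list.simps[of d n])
  next
    case 2
    have "prime n"
      using 2 "1.prems" by (intro prime_if_less_square[of n d]) auto
    then show ?thesis
      using 2 by (simp add: prime_factor_list.simps[of d n])
  next
    case 3
    have d: "d dvd n" "1 < d"
      using 3 "1.prems" by auto
    have "prime d"
      using d ge by (intro prime_if_least[of d n]) auto
    obtain k where k: "n = d * k"
      using d by (elim dvdE)
    have "0 < k"
      using k d "1.prems"(3) by (simp add: zero_less_mult_iff)
    have "prod_list (prime_factor_list d (n div d)) = n div d \<and> (\<forall>p\<in>set (prime_factor_list d (n div d)). prime p)"
      using 3 "1.prems" d k \<open>0 < k\<close> by (intro "1.IH"(1)) auto
    moreover have "prime_factor_list d n = d # prime_factor_list d (n div d)"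
      by (subst prime_factor_list.simps) (use 3 d in auto)
    ultimately show ?thesis
      using d \<open>prime d\<close> by simp
  next
    case 4
    let ?d = "if d = 2 then 3 else d + 2"
    have "?d \<le> p" if p: "prime p" "p dvd n" for p
    proof -
      have "d \<le> p" "d \<noteq> p"
        using ge[OF p] 4 p by auto
      moreover have "p \<noteq> d + 1" if "d \<noteq> 2"
        using "1.prems" that p prime_odd_int[of p] by auto
      ultimately show ?thesis by auto
    qed
    then have "prod_list (prime_factor_list ?d n) = n \<and> (\<forall>p\<in>set (prime_factor_list ?d n). prime p)"
      using 4 "1.prems" by (intro "1.IH"(2)) auto
    then show ?thesis
      using 4 "1.prems" by (simp add: prime_factor_list.simps[of d n])
  qed
qed

lemma prime_factor_list_2:
  assumes "0 < n"
  shows "prod_list (prime_factor_list 2 n) = n" "\<And>p. p \<in> set (prime_factor_list 2 n) \<Longrightarrow> prime p"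
  using prod_prime_factor_list[of 2 n] assms prime_ge_2_int by auto

lemma odd_part:
  assumes "0 < n"
  shows "odd (odd_part n)" "\<exists>j. n = 2 ^ j * odd_part n"
proof -
  have num: "odd (numeral (odd_num k) :: int) \<and> (\<exists>j. (numeral k :: int) = 2 ^ j * numeral (odd_num k))" for k
  proof (induction k)
    case (Bit0 k)
    then obtain j where j: "(numeral k :: int) = 2 ^ j * numeral (odd_num k)"
      by blast
    have "(numeral (num.Bit0 k) :: int) = 2 * numeral k"
      by (subst numeral_Bit0) (rule mult_2[symmetric])
    also have "\<dots> = 2 ^ Suc j * numeral (odd_num (num.Bit0 k))"
      by (simp only: j odd_num.simps power_Suc mult.assoc)
    finally have "\<exists>j. (numeral (num.Bit0 k) :: int) = 2 ^ j * numeral (odd_num (num.Bit0 k))"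
      by blast
    moreover have "odd (numeral (odd_num (num.Bit0 k)) :: int)"
      using Bit0 unfolding odd_num.simps by blast
    ultimately show ?case
      by blast
  qed (auto intro: exI[of _ 0])
  have "n = numeral (num_of_nat (nat n))"
    using assms by (simp add: numeral_num_of_nat_unfold)
  then show "odd (odd_part n)" "\<exists>j. n = 2 ^ j * odd_part n"
    using num[of "num_of_nat (nat n)"] assms by (simp_all add: odd_part_def)
qed

text \<open>The length bound survives an exhausted budget, because an unfactored rest n > 1 still
  contributes at least one prime. Only the claim that the entries are distinct primes depends on
  staying within the budget.\<close>

lemma odd_primes:
  fixes d n :: int
  assumes "odd d" "1 < d" "odd n" "0 < n" "\<And>p. prime p \<Longrightarrow> p dvd n \<Longrightarrow> d \<le> p"
  shows "length (odd_primes b d n) \<le> card (prime_factors n) \<and>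
    (int (length (odd_primes b d n)) \<le> b \<longrightarrow> distinct (odd_primes b d n) \<and> set (odd_primes b d n) \<subseteq> prime_factors n)"
  using assms
proof (induction b d n rule: odd_primes.induct)
  case (1 b d n)
  note ge = "1.prems"(5)
  have step: "d + 2 \<le> p" if p: "prime p" "p dvd n" "\<not> d dvd p" for p
  proof -
    have "d \<le> p" "p \<noteq> d"
      using ge[OF p(1,2)] p(3) by auto
    moreover have "odd p"
      using p(2) "1.prems"(3) by (meson dvd_trans)
    then have "p \<noteq> d + 1"
      using "1.prems"(1) by auto
    ultimately show ?thesis by linarith
  qed
  consider "n \<le> 1" | "1 < n" "b < 1" | "1 < n" "1 \<le> b" "n < d * d"
    | "1 < n" "1 \<le> b" "d * d \<le> n" "n mod d = 0" "n div d mod d = 0"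
    | "1 < n" "1 \<le> b" "d * d \<le> n" "n mod d = 0" "n div d mod d \<noteq> 0"
    | "1 < n" "1 \<le> b" "d * d \<le> n" "n mod d \<noteq> 0"
    by linarith
  then show ?case
  proof cases
    case 1
    then show ?thesis
      by (simp add: odd_primes.simps[of b d n])
  next
    case 2
    obtain p where "prime p" "p dvd n"
      using prime_divisor_exists[of n] 2 by auto
    then have "p \<in> prime_factors n"
      using 2 by (auto simp: prime_factors_dvd)
    then have "0 < card (prime_factors n)"
      by (auto simp: card_gt_0_iff)
    then show ?thesis
      using 2 by (simp add: odd_primes.simps[of b d n])
  next
    case 3
    have "prime n"
      using 3 "1.prems" by (intro prime_if_less_square[of n d]) auto
    then show ?thesis
      using 3 by (simp add: odd_primes.simps[of b d n] prime_prime_factors)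
  next
    case 4
    obtain k where k: "n = d * k"
      using 4 by (elim dvdE[OF mod_0_imp_dvd])
    have kd: "n div d = k"
      using k "1.prems"(2) by simp
    have "0 < k"
      using k "1.prems"(2,4) by (simp add: zero_less_mult_iff)
    have sub: "prime_factors k \<subseteq> prime_factors n"
      using k "1.prems"(4) by (intro dvd_prime_factors) auto
    have "length (odd_primes b d k) \<le> card (prime_factors k) \<and>
      (int (length (odd_primes b d k)) \<le> b \<longrightarrow> distinct (odd_primes b d k) \<and> set (odd_primes b d k) \<subseteq> prime_factors k)"
      unfolding kd[symmetric]
      by (rule "1.IH"(1)) (use 4 "1.prems" k kd \<open>0 < k\<close> ge in auto)
    moreover have "odd_primes b d n = odd_primes b d k"
      using 4 "1.prems"(2) kd by (simp add: odd_primes.simps[of b d n])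
    moreover have "card (prime_factors k) \<le> card (prime_factors n)"
      using sub by (intro card_mono) auto
    ultimately show ?thesis
      using sub by auto
  next
    case 5
    obtain k where k: "n = d * k"
      using 5 by (elim dvdE[OF mod_0_imp_dvd])
    have kd: "n div d = k"
      using k "1.prems"(2) by simp
    have "0 < k"
      using k "1.prems"(2,4) by (simp add: zero_less_mult_iff)
    have "\<not> d dvd k"
      using 5 kd by auto
    have "prime d"
      using "1.prems" k by (intro prime_if_least[of d n]) auto
    have sub: "insert d (prime_factors k) \<subseteq> prime_factors n"
      using k "1.prems"(4) \<open>prime d\<close> by (auto simp: in_prime_factors_iff)
    have nd: "d \<notin> prime_factors k"
      using \<open>\<not> d dvd k\<close> by auto
    have "length (odd_primes (b - 1) (d + 2) k) \<le> card (prime_factors k) \<and>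
      (int (length (odd_primes (b - 1) (d + 2) k)) \<le> b - 1 \<longrightarrow> distinct (odd_primes (b - 1) (d + 2) k) \<and>
        set (odd_primes (b - 1) (d + 2) k) \<subseteq> prime_factors k)"
      unfolding kd[symmetric]
    proof (rule "1.IH"(2))
      show "d + 2 \<le> p" if "prime p" "p dvd n div d" for p
        using that kd k \<open>prime d\<close> \<open>\<not> d dvd k\<close> by (intro step) (auto dest: primes_dvd_imp_eq)
    qed (use 5 "1.prems" k kd \<open>0 < k\<close> in auto)
    moreover have "odd_primes b d n = d # odd_primes (b - 1) (d + 2) k"
      using 5 "1.prems"(2) kd by (simp add: odd_primes.simps[of b d n])
    moreover have "Suc (card (prime_factors k)) \<le> card (prime_factors n)"
      using card_mono[OF _ sub] nd by simp
    ultimately show ?thesis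
      using sub nd by auto
  next
    case 6
    have "length (odd_primes b (d + 2) n) \<le> card (prime_factors n) \<and>
      (int (length (odd_primes b (d + 2) n)) \<le> b \<longrightarrow> distinct (odd_primes b (d + 2) n) \<and>
        set (odd_primes b (d + 2) n) \<subseteq> prime_factors n)"
    proof (rule "1.IH"(3))
      show "d + 2 \<le> p" if "prime p" "p dvd n" for p
        using that 6 by (intro step) auto
    qed (use 6 "1.prems" in auto)
    moreover have "odd_primes b d n = odd_primes b (d + 2) n"
      using 6 "1.prems"(2) by (simp add: odd_primes.simps[of b d n])
    ultimately show ?thesis
      by simp
  qed
qed

lemma distinct_primes:
  assumes "0 < n"
  shows "length (distinct_primes b n) \<le> card (prime_factors n)"
    "int (length (distinct_primes b n)) \<le> b \<Longrightarrow> distinct (distinct_primes b n) \<and> set (distinct_primes b n) \<subseteq> prime_factors n"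
proof -
  define m where "m = odd_part n"
  obtain j where m: "odd m" "n = 2 ^ j * m"
    using odd_part[OF assms] unfolding m_def by blast
  have "0 < m"
    using m assms by (simp add: zero_less_mult_iff)
  have ge: "3 \<le> p" if "prime p" "p dvd m" for p
  proof -
    have "p \<noteq> 2"
      using that m by auto
    then show ?thesis
      using prime_ge_2_int[OF that(1)] by linarith
  qed
  have *: "length (odd_primes c 3 m) \<le> card (prime_factors m) \<and>
    (int (length (odd_primes c 3 m)) \<le> c \<longrightarrow> distinct (odd_primes c 3 m) \<and> set (odd_primes c 3 m) \<subseteq> prime_factors m)" for c
    by (rule odd_primes) (use m \<open>0 < m\<close> ge in auto)
  have "length (distinct_primes b n) \<le> card (prime_factors n) \<and> (int (length (distinct_primes b n)) \<le> b \<longrightarrow>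
    distinct (distinct_primes b n) \<and> set (distinct_primes b n) \<subseteq> prime_factors n)"
  proof (cases "m = n")
    case True
    then show ?thesis
      using *[of b] by (simp add: distinct_primes_def distinct_primes1_def m_def)
  next
    case False
    then have "j \<noteq> 0"
      using m(2) by (intro notI) simp
    then have sub: "insert 2 (prime_factors m) \<subseteq> prime_factors n"
      using m(2) assms \<open>j \<noteq> 0\<close> by (auto simp: in_prime_factors_iff)
    have nd: "2 \<notin> prime_factors m"
      using m(1) by auto
    have "distinct_primes b n = 2 # odd_primes (b - 1) 3 m"
      using False by (simp add: distinct_primes_def distinct_primes1_def m_def)
    moreover have "Suc (card (prime_factors m)) \<le> card (prime_factors n)"
      using card_mono[OF _ sub] nd by simp
    ultimately show ?thesis
      using *[of "b - 1"] sub nd by auto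
  qed
  then show "length (distinct_primes b n) \<le> card (prime_factors n)"
    "int (length (distinct_primes b n)) \<le> b \<Longrightarrow> distinct (distinct_primes b n) \<and> set (distinct_primes b n) \<subseteq> prime_factors n"
    by auto
qed

lemma primepow_prime_dvd_eq:
  fixes p r q :: int
  assumes "primepow q" "prime p" "p dvd q" "prime r" "r dvd q"
  shows "p = r"
proof -
  obtain s k where s: "prime s" "q = s ^ k"
    using assms(1) by (auto simp: primepow_def)
  then have "p dvd s" "r dvd s"
    using assms prime_dvd_power by blast+
  then show ?thesis
    using s assms by (metis primes_dvd_imp_eq)
qed

lemma primepow_pos_int:
  fixes q :: int
  assumes "primepow q"
  shows "0 < q"
  using assms by (auto simp: primepow_def prime_gt_0_int)

lemma has_cofactor_imp_other_prime:
  fixes p q :: int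
  assumes "has_cofactor n p q" "prime p" "0 < q"
  shows "\<exists>r. prime r \<and> r dvd q \<and> r \<noteq> p"
  using assms
proof (induction n p q rule: has_cofactor.induct)
  case (2 n p q)
  show ?case
  proof (cases "q mod p = 0")
    case True
    then have "p dvd q" by auto
    then obtain k where k: "q = p * k" by (elim dvdE)
    moreover have "0 < k"
      using k "2.prems" prime_gt_0_int[of p] by (simp add: zero_less_mult_iff)
    ultimately have "\<exists>r. prime r \<and> r dvd k \<and> r \<noteq> p"
      using 2 True by auto
    then show ?thesis
      using k by auto
  next
    case False
    then have "q \<noteq> 1"
      using 2 by simp
    then obtain r where "prime r" "r dvd q"
      using prime_divisor_exists[of q] 2 by auto
    then show ?thesis
      using False by auto
  qed
qed simp

lemma not_mixed_primepow:
  assumes "primepow q" "\<And>p. p \<in> set ps \<Longrightarrow> prime p"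
  shows "\<not> mixed ps q"
  using assms(2)
proof (induction ps)
  case (Cons p ps)
  have "\<not> has_cofactor 12 p q" if "q mod p = 0"
  proof
    assume "has_cofactor 12 p q"
    then obtain r where "prime r" "r dvd q" "r \<noteq> p"
      using has_cofactor_imp_other_prime[of 12 p q] Cons.prems primepow_pos_int[OF assms(1)] by auto
    moreover have "p dvd q" "prime p"
      using that Cons.prems by auto
    ultimately show False
      using primepow_prime_dvd_eq[OF assms(1)] by blast
  qed
  then show ?case
    using Cons by simp
qed simp

lemma some_dvd_iff: "some_dvd F q \<longleftrightarrow> (\<exists>p\<in>set F. p dvd q)"
  by (induction F) auto

lemma list_mem_iff: "list_mem F q \<longleftrightarrow> q \<in> set F"
  by (induction F) auto

section \<open>Completeness of the enumerations\<close>

lemma check_smooth_covers: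
  assumes "check_smooth F P hi x" "0 < x" "0 < y" "x * y \<le> hi" "\<And>p. prime p \<Longrightarrow> p dvd y \<Longrightarrow> p \<in> set F"
  shows "P (x * y)"
  using assms
proof (induction F P hi x arbitrary: y rule: check_smooth.induct)
  case (1 P hi x)
  have "y = 1"
    using prime_divisor_exists[of y] 1 by (auto simp: zdvd1_eq)
  then show ?case
    using 1 by (simp add: check_smooth.simps split: if_splits)
next
  case (2 p ps P hi x)
  have "x \<le> x * y"
    using 2 by simp
  then have "x \<le> hi"
    using 2 by linarith
  then have sm: "check_smooth ps P hi x" "check_smooth (p # ps) P hi (x * p)" "2 \<le> p"
    using 2 by (auto simp: check_smooth.simps(2)[of p ps P hi x] split: if_splits)
  show ?case
  proof (cases "p dvd y")
    case True
    then obtain z where z: "y = p * z" by (elim dvdE)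
    have "0 < z"
      using z "2.prems"(3) sm by (simp add: zero_less_mult_iff)
    have "P (x * p * z)"
    proof (rule "2.IH"(2))
      show "r \<in> set (p # ps)" if "prime r" "r dvd z" for r
        using "2.prems"(5)[of r] that z by auto
    qed (use \<open>0 < z\<close> \<open>x \<le> hi\<close> sm z "2.prems"(2,4) in \<open>auto simp: mult.assoc\<close>)
    then show ?thesis
      using z by (simp add: mult.assoc)
  next
    case False
    show ?thesis
    proof (rule "2.IH"(1))
      show "r \<in> set ps" if "prime r" "r dvd y" for r
        using "2.prems"(5)[OF that] False that by auto
    qed (use \<open>x \<le> hi\<close> sm "2.prems"(2-4) in auto)
  qed
qed

lemma check_divisors_covers:
  assumes "check_divisors ps P x" "b dvd prod_list ps" "0 < b" "\<And>p. p \<in> set ps \<Longrightarrow> prime p"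
  shows "P (x * b)"
  using assms
proof (induction ps arbitrary: x b)
  case Nil
  then show ?case by (simp add: zdvd1_eq)
next
  case (Cons p ps)
  have p: "prime p" "0 < p"
    using Cons.prems by (auto intro: prime_gt_0_int)
  show ?case
  proof (cases "p dvd b")
    case True
    then obtain z where z: "b = p * z" by (elim dvdE)
    have "0 < z"
      using z p Cons.prems(3) by (simp add: zero_less_mult_iff)
    have "P (x * p * z)"
    proof (rule Cons.IH)
      show "check_divisors ps P (x * p)"
        using Cons.prems(1) by (simp split: if_splits)
      show "z dvd prod_list ps"
        using Cons.prems(2) z p by simp
    qed (use \<open>0 < z\<close> Cons.prems(4) in auto)
    then show ?thesis
      using z by (simp add: mult.assoc)
  next
    case False
    then have "coprime b p"
      using p prime_imp_coprime[of p b] by (simp add: coprime_commute)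
    then have "b dvd prod_list ps"
      using Cons.prems(2) by (simp add: coprime_dvd_mult_right_iff)
    moreover have "check_divisors ps P x"
      using Cons.prems(1) by (simp split: if_splits)
    ultimately show ?thesis
      using Cons.prems(3,4) by (intro Cons.IH) auto
  qed
qed

lemma check_powers_covers:
  assumes "check_powers p P lo hi x" "lo \<le> x * p ^ k" "x * p ^ k \<le> hi" "0 < x" "0 < p"
  shows "P (x * p ^ k)"
  using assms
proof (induction p P lo hi x arbitrary: k rule: check_powers.induct)
  case (1 p P lo hi x)
  have "x \<le> x * p ^ k"
    using "1.prems" by simp
  then have "x \<le> hi"
    using "1.prems" by linarith
  then have *: "2 \<le> p" "lo \<le> x \<Longrightarrow> P x" "check_powers p P lo hi (x * p)"
    using "1.prems"(1,4) by (auto simp: check_powers.simps[of p P lo hi x] split: if_splits)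
  show ?case
  proof (cases k)
    case 0
    then show ?thesis
      using "1.prems"(2) * by simp
  next
    case (Suc j)
    have "P (x * p * p ^ j)"
    proof (cases "x < lo")
      case True
      show ?thesis
        by (rule "1.IH"(1)) (use "1.prems" True \<open>x \<le> hi\<close> * Suc in \<open>auto simp: mult.assoc\<close>)
    next
      case False
      show ?thesis
        by (rule "1.IH"(2)) (use "1.prems" False \<open>x \<le> hi\<close> * Suc in \<open>auto simp: mult.assoc\<close>)
    qed
    then show ?thesis
      using Suc by (simp add: mult.assoc)
  qed
qed

lemma check_all_powers_covers:
  assumes "check_all_powers F P lo hi" "p \<in> set F" "1 < p" "lo \<le> p ^ k" "p ^ k \<le> hi" "0 < k"
  shows "P (p ^ k)"
proof -
  have "check_powers p P lo hi p"
    using assms(1,2) by (induction F) (auto split: if_splits)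
  then have "P (p * p ^ (k - 1))"
    by (rule check_powers_covers) (use assms in \<open>auto simp: power_eq_if\<close>)
  then show ?thesis
    using assms by (simp add: power_eq_if)
qed

lemma check_range_covers:
  assumes "check_range s P q hi" "q + s * int j \<le> hi" "0 < s"
  shows "P (q + s * int j)"
  using assms
proof (induction s P q hi arbitrary: j rule: check_range.induct)
  case (1 s P q hi)
  have "0 \<le> s * int j"
    using "1.prems"(3) by simp
  then have "q \<le> hi"
    using "1.prems" by linarith
  then have *: "q \<le> hi" "P q" "check_range s P (q + s) hi"
    using "1.prems"(1,3) by (auto simp: check_range.simps[of s P q hi] split: if_splits)
  show ?case
  proof (cases j)
    case (Suc i)
    have "P (q + s + s * int i)"
      by (rule "1.IH") (use "1.prems" * Suc in \<open>auto simp: algebra_simps\<close>)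
    then show ?thesis
      using Suc by (simp add: algebra_simps)
  qed (use * in simp)
qed

section \<open>Soundness of the search\<close>

lemma card_primes_le:
  fixes T :: "int set"
  assumes "finite T" "\<And>q. q \<in> T \<Longrightarrow> primepow q" "\<And>p. p \<in> G \<Longrightarrow> prime p" "\<And>p. p \<in> G \<Longrightarrow> p dvd \<Prod>T"
  shows "card G \<le> card T"
proof -
  have "\<exists>q\<in>T. p dvd q" if "p \<in> G" for p
    using assms that by (simp add: prime_dvd_prod_iff)
  then obtain f where f: "\<And>p. p \<in> G \<Longrightarrow> f p \<in> T \<and> p dvd f p"
    by metis
  \<comment> \<open>A prime power has only one prime divisor, so different primes pick different
    elements.\<close>
  then have "inj_on f G"
    using assms primepow_prime_dvd_eq by (intro inj_onI) metis
  then show ?thesis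
    using f assms(1) by (intro card_inj_on_le[of f]) auto
qed


definition sound_for :: "(int list \<Rightarrow> int \<Rightarrow> int \<Rightarrow> int \<Rightarrow> int \<Rightarrow> bool) \<Rightarrow> nat \<Rightarrow> bool" where
  "sound_for f m \<longleftrightarrow> (\<forall>S L Q A B lo. f L Q A B lo \<longrightarrow> (\<forall>p\<in>set L. 1 < p \<and> p dvd Q) \<longrightarrow>
     tail_system S m Q A B lo \<longrightarrow> Q * \<Prod>S \<in> set solutions)"

lemma not_conflict:
  assumes sys: "tail_system S (Suc m) Q A B lo" and q: "q \<in> S" "\<And>r. r \<in> S \<Longrightarrow> q \<le> r"
    and "\<And>p. p \<in> set L \<Longrightarrow> 1 < p \<and> p dvd Q"
  shows "\<not> conflict L B q"
  using assms(4)
proof (induction L)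
  case (Cons p L)
  have p: "1 < p" "p dvd Q"
    using Cons.prems by auto
  have "coprime q Q"
    using sys q by (auto simp: tail_system_def)
  then have "coprime q p"
    using p by (meson coprime_divisors dvd_refl)
  then have "q mod p \<noteq> 0"
    using p by (auto simp: coprime_absorb_right)
  moreover have "p dvd B" if "q mod p = 1"
  proof -
    have "p dvd q - 1"
      using that p by (metis mod_eq_dvd_iff mod_pos_pos_trivial less_imp_le zero_less_one less_trans)
    define d where "d = gcd (A * (q - 1)) (B * q)"
    have "coprime (A * (q - 1) div d) (Q * q)"
      using tail_system_coprime[OF tail_system_step[OF sys q]] by (simp add: d_def)
    then have "coprime (A * (q - 1) div d) p"
      using p by (meson coprime_divisors dvd_refl dvd_mult2)
    moreover have "p dvd (A * (q - 1) div d) * d"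
      using \<open>p dvd q - 1\<close> by (simp add: d_def)
    ultimately have "p dvd d"
      by (metis coprime_commute coprime_dvd_mult_right_iff)
    then have "p dvd B * q"
      by (auto simp: d_def)
    then show ?thesis
      using \<open>coprime q p\<close> by (metis coprime_commute coprime_dvd_mult_left_iff)
  qed
  ultimately show ?case
    using Cons by (auto simp: conflict1_def)
qed simp

lemma extend_sound:
  assumes "sound_for f m" "extend f L Q A B q"
    and sys: "tail_system S (Suc m) Q A B lo" and q: "q \<in> S" "\<And>r. r \<in> S \<Longrightarrow> q \<le> r"
    and L: "\<And>p. p \<in> set L \<Longrightarrow> 1 < p \<and> p dvd Q"
  shows "Q * \<Prod>S \<in> set solutions"
proof -
  define d where "d = gcd (A * (q - 1)) (B * q)"
  have sys': "tail_system (S - {q}) m (Q * q) (A * (q - 1) div d) (B * q div d) (q + 1)"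
    unfolding d_def by (rule tail_system_step[OF sys q])
  have "primepow q" "coprime q Q" "finite S"
    using sys q by (auto simp: tail_system_def)
  moreover have "\<not> mixed small_primes q"
    using \<open>primepow q\<close> by (rule not_mixed_primepow) (auto simp: small_primes_def)
  moreover have "gcd (A * (q - 1) div d) (Q * q) = 1"
    using tail_system_coprime[OF sys'] by simp
  ultimately have "f (q # L) (Q * q) (A * (q - 1) div d) (B * q div d) (q + 1)"
    using assms(2) not_conflict[OF sys q L]
    by (simp add: extend_def extend2_def extend3_def d_def split: if_splits)
  moreover have "1 < q"
    using tail_system_pos[OF sys q(1)] .
  ultimately have "Q * q * \<Prod>(S - {q}) \<in> set solutions"
    using assms(1) sys' L unfolding sound_for_def by (metis dvd_mult2 dvd_triv_right set_ConsD)
  moreover have "\<Prod>S = q * \<Prod>(S - {q})"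
    using \<open>finite S\<close> q(1) by (rule prod.remove)
  ultimately show ?thesis
    by (simp add: mult.assoc)
qed

text \<open>
  If \<open>A\<close> already has one prime for each element of \<open>S\<close> but \<open>q\<close>, then \<open>q - 1\<close> can contribute no new
  prime: up to a divisor of \<open>B\<close> it is smooth over the primes of \<open>A\<close>.
\<close>

lemma smooth_cofactor:
  assumes sys: "tail_system S (Suc (card G)) Q A B lo" and "q \<in> S"
    and G: "finite G" "\<And>p. p \<in> G \<Longrightarrow> prime p \<and> p dvd A \<and> \<not> p dvd q"
    and r: "prime r" "r dvd (q - 1) div gcd (q - 1) B"
  shows "r \<in> G"
proof (rule ccontr)
  assume "r \<notin> G"
  define T where "T = S - {q}"
  define b where "b = gcd (q - 1) B"
  have fin: "finite S" and "card S \<le> Suc (card G)" and "0 < B"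
    and pp: "\<And>q. q \<in> S \<Longrightarrow> primepow q" and eq: "B * \<Prod>S = A * (\<Prod>q\<in>S. q - 1)"
    using sys by (auto simp: tail_system_def)
  have S: "\<Prod>S = q * \<Prod>T" "(\<Prod>q\<in>S. q - 1) = (q - 1) * (\<Prod>q\<in>T. q - 1)"
    unfolding T_def using fin \<open>q \<in> S\<close> by (simp_all add: prod.remove)
  have "1 < q"
    using tail_system_pos[OF sys \<open>q \<in> S\<close>] .
  have b: "0 < b" "b dvd B" "b dvd q - 1"
    using \<open>0 < B\<close> by (auto simp: b_def)
  have cop: "coprime ((q - 1) div b) (B div b)"
    unfolding b_def using \<open>0 < B\<close> by (intro div_gcd_coprime) auto
  have "b * (B div b * (q * \<Prod>T)) = b * ((q - 1) div b * (A * (\<Prod>q\<in>T. q - 1)))"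
    using eq b unfolding S by (simp add: mult.assoc[symmetric])
  then have eq': "B div b * (q * \<Prod>T) = (q - 1) div b * (A * (\<Prod>q\<in>T. q - 1))"
    using b by simp
  have "r dvd q - 1"
    using r(2) b(3) by (metis b_def div_dvd_iff_mult dvd_mult_left dvd_div_mult_self dvd_mult2)
  then have "\<not> r dvd q"
    using r(1) by (metis dvd_diffD not_prime_unit diff_diff_eq2 add_diff_cancel_left' dvd_diff)
  moreover have "\<not> r dvd B div b"
    using cop r unfolding b_def[symmetric] by (meson coprime_common_divisor not_prime_unit)
  moreover have "r dvd B div b * (q * \<Prod>T)"
    unfolding eq' using r(2) by (simp add: b_def)
  ultimately have "r dvd \<Prod>T"
    using r(1) by (simp add: prime_dvd_mult_iff)
  moreover have "p dvd \<Prod>T" if "p \<in> G" for p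
  proof -
    have "p dvd q * \<Prod>T"
      using tail_system_dvd_prod[OF sys] G(2)[OF that] S by (metis dvd_trans)
    then show ?thesis
      using G(2)[OF that] by (simp add: prime_dvd_mult_iff)
  qed
  ultimately have "card (insert r G) \<le> card T"
    using fin pp G r by (intro card_primes_le) (auto simp: T_def)
  moreover have "card T < Suc (card G)"
    using fin \<open>q \<in> S\<close> \<open>card S \<le> Suc (card G)\<close> by (simp add: T_def)
  ultimately show False
    using \<open>r \<notin> G\<close> G(1) by simp
qed

lemma expand_sound:
  assumes f: "sound_for f m" and ex: "expand f (int m) L Q A B lo"
    and sys: "tail_system S (Suc m) Q A B lo" and "B < A"
    and L: "\<And>p. p \<in> set L \<Longrightarrow> 1 < p \<and> p dvd Q"
  shows "Q * \<Prod>S \<in> set solutions"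
proof -
  define F where "F = distinct_primes (int m + 1) A"
  define lo' where "lo' = max lo ((2 * A - B - 1) div (A - B))"
  define hi where "hi = (A + int m * B) div (A - B)"
  have AB: "0 < A" "0 < B" and fin: "finite S" and card: "card S \<le> Suc m"
    and pp: "\<And>q. q \<in> S \<Longrightarrow> primepow q"
    using sys by (auto simp: tail_system_def)
  have "S \<noteq> {}"
    using tail_system_empty_iff[OF sys] \<open>B < A\<close> by auto
  define q where "q = Min S"
  have q: "q \<in> S" "\<And>r. r \<in> S \<Longrightarrow> q \<le> r"
    using fin \<open>S \<noteq> {}\<close> by (auto simp: q_def)
  have "1 < q"
    using tail_system_pos[OF sys q(1)] .
  note bds = tail_system_next_bounds[OF sys q]
  have "lo \<le> q"
    using sys q by (auto simp: tail_system_def)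
  moreover have "(2 * A - B - 1) div (A - B) \<le> q"
  proof -
    have "2 * A - B - 1 < (q + 1) * (A - B)"
      using bds(1) by (simp add: algebra_simps)
    moreover have "(2 * A - B - 1) div (A - B) * (A - B) \<le> 2 * A - B - 1"
      using pos_mod_sign[of "A - B" "2 * A - B - 1"] \<open>B < A\<close>
        div_mult_mod_eq[of "2 * A - B - 1" "A - B"] by linarith
    ultimately have "(2 * A - B - 1) div (A - B) * (A - B) < (q + 1) * (A - B)"
      by linarith
    then show ?thesis
      using \<open>B < A\<close> by simp
  qed
  ultimately have lo': "lo' \<le> q"
    by (simp add: lo'_def)
  have hi: "q \<le> hi"
    using zdiv_mono1[OF bds(2), of "A - B"] \<open>B < A\<close> by (simp add: hi_def)
  note pfsB = prime_factor_list_2[OF AB(2)]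
  have "card (prime_factors A) \<le> card S"
  proof (rule card_primes_le)
    show "p dvd \<Prod>S" if "p \<in> prime_factors A" for p
      using that tail_system_dvd_prod[OF sys] by (auto intro: dvd_trans)
  qed (use fin pp in auto)
  then have "length F \<le> Suc m"
    using distinct_primes(1)[OF AB(1), of "int m + 1"] card by (simp add: F_def)
  then have lenF: "length F \<le> Suc m" and dF: "distinct F" "set F \<subseteq> prime_factors A"
    using distinct_primes(2)[OF AB(1), of "int m + 1"] by (auto simp: F_def)
  have F: "prime p" "p dvd A" if "p \<in> set F" for p
    using that dF by auto
  have len: "length F = card (set F)"
    using dF by (simp add: distinct_card)
  have dvdS: "p dvd \<Prod>S" if "p \<in> set F" for p
    using F(2)[OF that] tail_system_dvd_prod[OF sys] by (rule dvd_trans)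
  let ?P = "extend f L Q A B" and ?S = "extend_new f L F Q A B"
  have ex: "expand3 (int m) F ?P ?S B lo' hi (int (length F))"
    using ex lo' hi by (simp add: expand_def expand1_def expand2_def F_def lo'_def hi_def split: if_splits)
  then have pw: "check_all_powers F ?P lo' hi"
    using lenF by (simp add: expand3_def split: if_splits)
  have "?P q"
  proof (cases "\<exists>p\<in>set F. p dvd q")
    case True
    then obtain p where p: "p \<in> set F" "p dvd q"
      by auto
    obtain s k where s: "prime s" "0 < k" "q = s ^ k"
      using pp[OF q(1)] by (auto simp: primepow_def)
    have "s = p"
      using primepow_prime_dvd_eq[OF pp[OF q(1)] s(1) _ F(1)[OF p(1)] p(2)] s by simp
    have "?P (p ^ k)"
      using prime_gt_1_int[OF F(1)[OF p(1)]] lo' hi s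
      by (intro check_all_powers_covers[OF pw p(1)]) (auto simp: \<open>s = p\<close>)
    then show ?thesis
      using s \<open>s = p\<close> by simp
  next
    case False
    \<comment> \<open>None of the primes in F divides q, so the other elements must supply all of
      them, each at most one.\<close>
    have "p dvd \<Prod>(S - {q})" if "p \<in> set F" for p
    proof -
      have "\<Prod>S = q * \<Prod>(S - {q})"
        using fin q(1) by (rule prod.remove)
      then show ?thesis
        using dvdS[OF that] F(1)[OF that] False that by (simp add: prime_dvd_mult_iff)
    qed
    then have "length F \<le> card (S - {q})"
      unfolding len using fin pp F by (intro card_primes_le) auto
    then have "length F \<le> m"
      using fin q(1) card by simp
    have extend_new: "?P q" if "?S q"
      using that False by (auto simp: extend_new_def some_dvd_iff split: if_splits)
    have sc1: "?P q" if "check_range 1 ?S lo' hi"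
    proof -
      have "?S (lo' + 1 * int (nat (q - lo')))"
        by (rule check_range_covers[OF that]) (use lo' hi in auto)
      then show ?thesis
        using lo' extend_new by simp
    qed
    consider "length F = m" "lo' + 10 < hi" | "check_range 1 ?S lo' hi"
      | "2 \<in> set F" "check_range 2 ?S (lo' + (if lo' mod 2 = 0 then 1 else 0)) hi"
      using ex \<open>length F \<le> m\<close> by (auto simp: expand3_def list_mem_iff split: if_splits)
    then show ?thesis
    proof cases
      case 1
      \<comment> \<open>With q - 1 = b * c, b runs through the divisors of B in
        \<open>check_divisors\<close>, the smooth cofactor c through \<open>check_smooth\<close>,
        and \<open>check_succ\<close> adds the 1 back.\<close>
      define b where "b = gcd (q - 1) B"
      have b: "0 < b" "b dvd B" "b dvd q - 1"
        using AB by (auto simp: b_def)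
      then obtain c where c: "q - 1 = b * c"
        by (elim dvdE)
      then have "0 < b * c"
        using \<open>1 < q\<close> by linarith
      then have "0 < c"
        using b by (simp add: zero_less_mult_iff)
      have dv: "check_divisors (prime_factor_list 2 B) (check_smooth F (check_succ ?P lo') (hi - 1)) 1"
        using ex 1 by (simp add: expand3_def split: if_splits)
      have sm: "check_smooth F (check_succ ?P lo') (hi - 1) (1 * b)"
        by (rule check_divisors_covers[OF dv]) (use b pfsB in auto)
      have "p \<in> set F" if "prime p" "p dvd c" for p
      proof -
        have "p dvd (q - 1) div gcd (q - 1) B"
          using that c b(1) unfolding b_def[symmetric] by simp
        moreover have "tail_system S (Suc (card (set F))) Q A B lo"
          using sys 1(1) len by simp
        ultimately show ?thesis
          using that(1) q(1) F False smooth_cofactor[of S "set F" Q A B lo q p] by blast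
      qed
      then have "check_succ ?P lo' (1 * b * c)"
        by (intro check_smooth_covers[OF sm]) (use b(1) \<open>0 < c\<close> hi c in auto)
      then have "check_succ ?P lo' (b * c)"
        by simp
      moreover have "b * c + 1 = q"
        using c by simp
      ultimately show ?thesis
        using lo' by (simp add: check_succ_def)
    next
      case 2
      then show ?thesis
        by (rule sc1)
    next
      case 3
      define st where "st = lo' + (if lo' mod 2 = 0 then 1 else 0)"
      have "odd q"
        using False 3 by auto
      moreover have "odd st" "st \<le> q"
        using lo' \<open>odd q\<close> by (auto simp: st_def order.order_iff_strict intro: ccontr)
      ultimately have eq: "st + 2 * int (nat ((q - st) div 2)) = q"
        by simp
      have "?S (st + 2 * int (nat ((q - st) div 2)))"
        by (rule check_range_covers[OF 3(2)[folded st_def]]) (use eq hi in auto)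
      then show ?thesis
        unfolding eq by (rule extend_new)
    qed
  qed
  then show ?thesis
    using extend_sound[OF f _ sys q L] by blast
qed

text \<open>
  The state after fixing 3, 5, 17 and 257 with three prime powers left is excluded from the search:
  there the least candidate ranges over an interval of length \<open>2 * 65536\<close>.
\<close>

definition fermat_branch :: bool where
  "fermat_branch \<longleftrightarrow> (\<forall>S lo. tail_system S 3 65535 65536 65535 lo \<longrightarrow> 65535 * \<Prod>S \<in> set solutions)"

text \<open>The exempted state has three elements left, so a search of depth at most 2 never meets
  it. Allowing m \<le> 2 without \<open>fermat_branch\<close> lets such a search be used in the
  proof of \<open>fermat_branch\<close> itself.\<close>

lemma search_sound:
  assumes "m \<le> 2 \<or> fermat_branch"
  shows "sound_for (search m) m"
  using assms
proof (induction m)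
  case 0
  show ?case
    unfolding sound_for_def
  proof (intro allI impI)
    fix S L Q A B lo
    assume *: "search 0 L Q A B lo" "tail_system S 0 Q A B lo"
    then have "S = {}"
      by (auto simp: tail_system_def)
    then show "Q * \<Prod>S \<in> set solutions"
      using * tail_system_empty_iff(2)[OF *(2)] by (simp add: list_mem_iff)
  qed
next
  case (Suc m)
  show ?case
    unfolding sound_for_def
  proof (intro allI impI)
    fix S L Q A B lo
    assume s: "search (Suc m) L Q A B lo" and L: "\<forall>p\<in>set L. 1 < p \<and> p dvd Q"
      and sys: "tail_system S (Suc m) Q A B lo"
    show "Q * \<Prod>S \<in> set solutions"
    proof (cases "A = B")
      case True
      then show ?thesis
        using s tail_system_empty_iff(2)[OF sys] by (simp add: list_mem_iff)
    next
      case False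
      then have "B < A" "S \<noteq> {}"
        using tail_system_empty_iff[OF sys] by auto
      have le: "\<not> B * (lo + int m) < A * (lo - 1)"
        using tail_system_le[OF sys] by simp
      consider "m = 0" | "Q = 65535" "A = 65536" "B = 65535" "m = 2" | "expand (search m) (int m) L Q A B lo"
        using s \<open>B < A\<close> le by (auto split: if_splits)
      then show ?thesis
      proof cases
        case 1
        have fin: "finite S" "card S \<le> 1"
          using sys 1 by (auto simp: tail_system_def)
        then have "card S = 1"
          using \<open>S \<noteq> {}\<close> by (simp add: le_Suc_eq)
        then obtain q where S: "S = {q}"
          by (auto simp: card_1_singleton_iff)
        have q: "primepow q" "1 < q" "B * q = A * (q - 1)" "coprime A B" "0 < A"
          using sys tail_system_pos[OF sys] S by (auto simp: tail_system_def)
        have "A dvd q"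
          using tail_system_dvd_prod[OF sys] S by simp
        moreover have "(A - B) * q = A"
          using q(3) by (simp add: algebra_simps)
        then have "q dvd A"
          by (metis dvd_triv_right)
        ultimately have "q = A"
          using q by (simp add: zdvd_antisym_nonneg)
        then have "A = B + 1"
          using \<open>(A - B) * q = A\<close> q by simp
        moreover have "\<not> mixed small_primes A"
          using q(1) unfolding \<open>q = A\<close> by (rule not_mixed_primepow) (auto simp: small_primes_def)
        ultimately show ?thesis
          using s 1 le \<open>B < A\<close> S \<open>q = A\<close> by (simp add: list_mem_iff)
      next
        case 2
        then have "tail_system S 3 65535 65536 65535 lo" fermat_branch
          using sys Suc.prems by (simp_all add: eval_nat_numeral)
        then show ?thesis
          unfolding fermat_branch_def 2(1) by blast
      next
        case 3
        then show ?thesis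
          using Suc.prems L by (intro expand_sound[OF Suc.IH 3 sys \<open>B < A\<close>]) auto
      qed
    qed
  qed
qed

section \<open>The branch 3, 5, 17, 257\<close>

lemma odd_part_unique:
  fixes a b :: int
  assumes "2 ^ i * a = 2 ^ j * b" "odd a" "odd b"
  shows "i = j" "a = b"
proof -
  have "multiplicity 2 (2 ^ k * c) = k" if "odd c" for k and c :: int
    by (rule multiplicity_eqI) (use that in \<open>auto simp: mult.commute\<close>)
  from this[of a i] this[of b j] show "i = j"
    using assms by metis
  then show "a = b"
    using assms by simp
qed

lemma exists_odd_part:
  fixes x :: int
  assumes "x \<noteq> 0"
  obtains i a where "x = 2 ^ i * a" "odd a"
proof -
  obtain a where "x = 2 ^ multiplicity 2 x * a" "odd a"
    by (rule multiplicity_decompose'[of x 2]) (use assms in auto)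
  then show ?thesis ..
qed

lemma square_dvd_65535:
  fixes g :: int
  assumes "g * g dvd 65535" "0 < g"
  shows "g = 1"
proof (rule ccontr)
  assume "g \<noteq> 1"
  have "g * g \<le> 65535"
    using assms(1) by (simp add: zdvd_imp_le)
  then have "g * g < 256 * 256"
    by simp
  then have "g < 256"
    using mult_mono[of 256 g 256 g] by linarith
  then have g: "g \<in> set [2..255]"
    unfolding set_upto using assms(2) \<open>g \<noteq> 1\<close> by auto
  have "list_all (\<lambda>g. 65535 mod (g * g) \<noteq> 0) [2..255::int]"
    by code_simp
  then have "65535 mod (g * g) \<noteq> 0"
    unfolding list_all_iff using g by (rule bspec)
  then show False
    using assms(1) by auto
qed

text \<open>A common divisor g of u, v and 65535 would make g * g divide 65535 * z; as z is coprime
  to g, g * g would divide the squarefree number 65535.\<close>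

lemma gcd_coprime_65535:
  fixes u v w z :: int
  assumes "u * (v * w) = 65535 * z" "coprime z 65535" "u \<noteq> 0" "v \<noteq> 0"
  shows "coprime (gcd u 65535) (gcd v 65535)"
proof -
  define g where "g = gcd (gcd u 65535) (gcd v 65535)"
  have g: "g dvd u" "g dvd v" "g dvd 65535" "0 < g"
    by (auto simp: g_def intro: dvd_trans[OF gcd_dvd1] dvd_trans[OF gcd_dvd2])
  have "g * g dvd u * (v * w)"
    using g by (simp add: mult.assoc[symmetric] mult_dvd_mono)
  then have "g * g dvd 65535 * z"
    using assms by simp
  moreover have "coprime (g * g) z"
    using assms(2) g(3) by (metis coprime_commute coprime_divisors coprime_mult_left_iff dvd_refl)
  ultimately have "g * g dvd 65535"
    by (simp add: coprime_dvd_mult_left_iff)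
  then have "g = 1"
    using g square_dvd_65535 by blast
  then show ?thesis
    by (simp add: g_def coprime_iff_gcd_eq_1)
qed

text \<open>One divisibility combines three pairwise coprime divisors of 65535. The other splits
  65535, a divisor of u * (v * w), into a divisor of each factor.\<close>

lemma prod_gcd_65535:
  fixes u v w z :: int
  assumes eq: "u * (v * w) = 65535 * z" and z: "coprime z 65535" and nz: "u \<noteq> 0" "v \<noteq> 0" "w \<noteq> 0"
  shows "gcd u 65535 * (gcd v 65535 * gcd w 65535) = 65535"
proof (rule zdvd_antisym_nonneg)
  have "coprime (gcd u 65535) (gcd v 65535)" "coprime (gcd u 65535) (gcd w 65535)" "coprime (gcd v 65535) (gcd w 65535)"
    using gcd_coprime_65535[of u v w z] gcd_coprime_65535[of u w v z] gcd_coprime_65535[of v w u z] eq z nz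
    by (simp_all add: ac_simps)
  then show "gcd u 65535 * (gcd v 65535 * gcd w 65535) dvd 65535"
    by (intro divides_mult) auto
  have "65535 dvd u * (v * w)"
    using eq by simp
  then obtain x y1 where 1: "65535 = x * y1" "x dvd u" "y1 dvd v * w"
    by (metis division_decomp)
  then obtain y y2 where 2: "y1 = y * y2" "y dvd v" "y2 dvd w"
    by (metis division_decomp)
  have xy: "65535 = x * (y * y2)"
    using 1(1) 2(1) by simp
  have "x dvd 65535" "y dvd 65535" "y2 dvd 65535"
    by (subst xy, simp)+
  then have "x * (y * y2) dvd gcd u 65535 * (gcd v 65535 * gcd w 65535)"
    by (intro mult_dvd_mono gcd_greatest 1(2) 2(2) 2(3))
  then show "65535 dvd gcd u 65535 * (gcd v 65535 * gcd w 65535)"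
    by (simp only: xy[symmetric])
qed auto

text \<open>
  The remaining prime powers are \<open>X\<close>, \<open>Y\<close> and \<open>2 ^ (16 + n)\<close>. Each of 3, 5, 17, 257 divides exactly one
  of \<open>X - 1\<close>, \<open>Y - 1\<close>, \<open>2 ^ (16 + n) - 1\<close>, which gives \<open>D\<close>, \<open>E\<close>, \<open>F\<close>.
\<close>

definition fermat_triple where
  "fermat_triple n i k A B D E F g h X Y \<longleftrightarrow>
     0 < A \<and> 0 < B \<and> 0 < g \<and> 0 < h \<and> 0 < D \<and> 0 < E \<and> 0 < F \<and> 0 < i \<and> 0 < k \<and> n = i + k \<and>
     X = B * g \<and> X = 1 + 2 ^ i * D * A \<and> Y = A * h \<and> Y = 1 + 2 ^ k * E * B \<and>
     F * (g * h) = 65536 * 2 ^ n - 1 \<and> D * (E * F) = 65535 \<and> F = gcd (65536 * 2 ^ n - 1) 65535 \<and> X < Y \<and>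
     primepow X \<and> primepow Y \<and> coprime X Y \<and> coprime X 65535 \<and> coprime Y (65535::int)"

lemma coprime_one_plus_mult: "coprime a (1 + c * a :: int)"
proof (rule coprimeI)
  fix d assume "d dvd a" "d dvd 1 + c * a"
  then have "d dvd 1 + c * a - c * a"
    by (intro dvd_diff dvd_mult)
  then show "is_unit d"
    by simp
qed

text \<open>The equation \<open>eq\<close> is the ratio condition for 2^(16 + n), X and Y with the
  common factor 2^16 cancelled.\<close>

lemma fermat_triple_exists:
  fixes X Y :: int
  assumes eq: "65535 * (2 ^ n * (X * Y)) = (X - 1) * ((Y - 1) * (65536 * 2 ^ n - 1))"
    and XY: "primepow X" "primepow Y" "coprime X Y" "coprime X 65535" "coprime Y 65535" "odd X" "odd Y" "X < Y"
  obtains i k A B D E F g h where "fermat_triple n i k A B D E F g h X Y"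
proof -
  have gt: "1 < X" "1 < Y"
    using XY primepow_gt_Suc_0 primepow_pos_int[OF XY(1)] primepow_not_unit[OF XY(1)] by auto
  define w :: int where "w = 65536 * 2 ^ n - 1"
  define D where "D = gcd (X - 1) 65535"
  define E where "E = gcd (Y - 1) 65535"
  define F where "F = gcd w 65535"
  have "1 \<le> (2::int) ^ n" by simp
  then have "0 < w"
    unfolding w_def by linarith
  then have w: "0 < w" "odd w"
    by (auto simp: w_def)
  have "coprime (2 ^ n * (X * Y)) 65535"
    using XY by simp
  then have DEF: "D * (E * F) = 65535"
    unfolding D_def E_def F_def
    by (intro prod_gcd_65535[of _ _ _ "2 ^ n * (X * Y)"]) (use eq gt w in \<open>auto simp: w_def\<close>)
  have pos: "0 < D" "0 < E" "0 < F"
    by (auto simp: D_def E_def F_def)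
  obtain x where x: "X - 1 = D * x"
    unfolding D_def by (meson dvdE gcd_dvd1)
  obtain y where y: "Y - 1 = E * y"
    unfolding E_def by (meson dvdE gcd_dvd1)
  obtain z where z: "w = F * z"
    unfolding F_def by (meson dvdE gcd_dvd1)
  have xyz: "0 < x" "0 < y" "0 < z"
    using x y z gt w pos by (metis zero_less_mult_pos diff_gt_0_iff_gt)+
  obtain i A where A: "x = 2 ^ i * A" "odd A"
    using exists_odd_part[of x] xyz by auto
  obtain k B where B: "y = 2 ^ k * B" "odd B"
    using exists_odd_part[of y] xyz by auto
  have AB: "0 < A" "0 < B"
    using A B xyz by (simp_all add: zero_less_mult_iff)
  have "odd z"
    using z w by auto
  have "65535 * (2 ^ n * (X * Y)) = D * (E * F) * (x * (y * z))"
    using eq unfolding w_def[symmetric] x y z by (simp add: ac_simps)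
  then have "2 ^ n * (X * Y) = x * (y * z)"
    unfolding DEF by simp
  \<comment> \<open>Once 65535 is cancelled, X, Y, A, B and z are odd, so powers of 2 and odd parts
    can be compared separately.\<close>
  then have "2 ^ (i + k) * (A * (B * z)) = 2 ^ n * (X * Y)"
    unfolding A B by (simp add: power_add ac_simps)
  then have n: "i + k = n" and ABz: "A * (B * z) = X * Y"
    using odd_part_unique[of "i + k" "A * (B * z)" n "X * Y"] A B \<open>odd z\<close> XY by auto
  have X1: "X = 1 + 2 ^ i * D * A" and Y1: "Y = 1 + 2 ^ k * E * B"
    using x y A B by (auto simp: algebra_simps)
  \<comment> \<open>A divides X - 1 and X * Y, so it must divide Y; likewise B divides X. The
    cofactors are g and h.\<close>
  have "coprime A X" "coprime B Y"
    unfolding X1 Y1 by (rule coprime_one_plus_mult)+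
  then have "A dvd Y" "B dvd X"
    using ABz by (metis coprime_dvd_mult_right_iff dvd_triv_left mult.left_commute mult.commute)+
  then obtain g h where X2: "X = B * g" and Y2: "Y = A * h"
    by (auto elim!: dvdE)
  have gh: "0 < g" "0 < h"
    using X2 Y2 AB gt by (metis zero_less_mult_pos less_trans zero_less_one)+
  have "A * B * z = A * B * (g * h)"
    using ABz unfolding X2 Y2 by (simp add: ac_simps)
  then have "z = g * h"
    using AB by simp
  have "D dvd 65535" "E dvd 65535"
    by (auto simp: D_def E_def)
  then have "odd D" "odd E"
    by (metis dvd_trans odd_numeral)+
  then have ik: "0 < i" "0 < k"
    using X1 Y1 XY A B by (auto intro: gr0I)
  have "fermat_triple n i k A B D E F g h X Y"
    unfolding fermat_triple_def
    using AB gh pos ik n[symmetric] X2 X1 Y2 Y1 z[unfolded w_def \<open>z = g * h\<close>, symmetric] DEF F_def[unfolded w_def]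
      XY(8) XY(1-5)
    by (intro conjI) assumption+
  then show ?thesis ..
qed

text \<open>B * g = 1 + 2^i * D * A and A * h = 1 + 2^k * E * B are linear in A and B, and D * E * F
  = 65535 reduces F times the determinant to 2^n - 1 up to sign. The third identity is what bounds
  n.\<close>

lemma fermat_triple_A:
  assumes "fermat_triple n i k A B D E F g h X Y"
  shows "(2 ^ n - 1) * A = F * (g + 2 ^ k * E)" "(2 ^ n - 1) * B = F * (h + 2 ^ i * D)"
    "2 ^ n * (X - 65536) = X - 1 + 2 ^ i * D * F * g"
proof -
  have X: "X = B * g" "X = 1 + 2 ^ i * D * A" and Y: "Y = A * h" "Y = 1 + 2 ^ k * E * B"
    and w: "F * (g * h) = 65536 * 2 ^ n - 1" and DEF: "D * (E * F) = 65535" and n: "n = i + k"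
    and pos: "0 < A" "0 < B"
    using assms by (auto simp: fermat_triple_def)
  have "A * (65536 * 2 ^ n - 1) = F * g * Y"
    unfolding w[symmetric] Y(1) by (simp add: ac_simps)
  also have "\<dots> = F * g + 2 ^ k * E * F * X"
    unfolding Y(2) X(1) by (simp add: algebra_simps)
  also have "\<dots> = F * g + 2 ^ k * E * F + 2 ^ n * (D * (E * F)) * A"
    unfolding X(2) n by (simp add: algebra_simps power_add)
  finally show A: "(2 ^ n - 1) * A = F * (g + 2 ^ k * E)"
    unfolding DEF by (simp add: algebra_simps)
  have "B * (65536 * 2 ^ n - 1) = F * h * X"
    unfolding w[symmetric] X(1) by (simp add: ac_simps)
  also have "\<dots> = F * h + 2 ^ i * D * F * Y"
    unfolding X(2) Y(1) by (simp add: algebra_simps)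
  also have "\<dots> = F * h + 2 ^ i * D * F + 2 ^ n * (D * (E * F)) * B"
    unfolding Y(2) n by (simp add: algebra_simps power_add)
  finally show "(2 ^ n - 1) * B = F * (h + 2 ^ i * D)"
    unfolding DEF by (simp add: algebra_simps)
  have "(2 ^ n - 1) * (X - 1) = 2 ^ i * D * ((2 ^ n - 1) * A)"
    unfolding X(2) by (simp add: ac_simps)
  also have "\<dots> = 2 ^ i * D * (F * (g + 2 ^ k * E))"
    by (simp only: A)
  also have "\<dots> = 2 ^ i * D * F * g + 2 ^ n * (D * (E * F))"
    unfolding n by (simp add: algebra_simps power_add)
  finally show "2 ^ n * (X - 65536) = X - 1 + 2 ^ i * D * F * g"
    unfolding DEF by (simp add: algebra_simps)
qed

text \<open>Since X < Y, the smaller prime power X cannot be much larger than 2 * 65536, or the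
  product of ratios would be too small. As g and 2^i * D are at most X, the third identity of
  \<open>fermat_triple_A\<close> with X > 65536 then bounds 2^n.\<close>

lemma fermat_triple_bounds:
  assumes t: "fermat_triple n i k A B D E F g h X Y"
  shows "X \<le> 174761" "g \<le> 174761" "2 ^ n \<le> 174761 + F * 174761 ^ 2"
proof -
  have X: "X = B * g" "X = 1 + 2 ^ i * D * A" and pos: "0 < A" "0 < B" "0 < g" "0 < F" "0 < D"
    and n: "n = i + k" "0 < i" "0 < k" and "X < Y"
    using t by (auto simp: fermat_triple_def)
  have X65: "65536 < X"
  proof -
    have "0 < X - 1 + 2 ^ i * D * F * g"
      using X(2) pos by (simp add: add_pos_pos)
    then have "0 < 2 ^ n * (X - 65536)"
      by (simp only: fermat_triple_A(3)[OF t])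
    then show ?thesis
      by (simp add: zero_less_mult_iff)
  qed
  have "(2::int) ^ 2 \<le> 2 ^ n"
    using n by (intro power_increasing) auto
  then have W: "4 \<le> (2::int) ^ n"
    by simp
  have "1 * g \<le> B * g" "(2 ^ i * D) * 1 \<le> (2 ^ i * D) * A"
    using pos by (intro mult_right_mono mult_left_mono; simp)+
  then have gX: "g \<le> X" "2 ^ i * D \<le> X - 1"
    using X by linarith+
  have "2 ^ n * (X - 131071) \<le> X - 1"
  proof -
    have "A * h * (B * g) = Y * X"
      using t by (simp add: fermat_triple_def)
    have eq: "(65536 * 2 ^ n - 1) * ((X - 1) * (Y - 1)) = 65535 * 2 ^ n * (X * Y)"
    proof -
      have "(65536 * 2 ^ n - 1) * ((X - 1) * (Y - 1)) = F * (g * h) * ((2 ^ i * D * A) * (2 ^ k * E * B))"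
        using t by (auto simp: fermat_triple_def)
      also have "\<dots> = D * (E * F) * 2 ^ n * ((B * g) * (A * h))"
        unfolding n by (simp add: power_add ac_simps)
      also have "\<dots> = 65535 * 2 ^ n * (X * Y)"
        using t by (auto simp: fermat_triple_def)
      finally show ?thesis .
    qed
    \<comment> \<open>In ratios: Y / (Y - 1) \<le> (X + 1) / X. This eliminates Y.\<close>
    have "X * Y \<le> (X + 1) * (Y - 1)"
      using \<open>X < Y\<close> by (simp add: algebra_simps)
    then have "65535 * 2 ^ n * (X * Y) \<le> 65535 * 2 ^ n * ((X + 1) * (Y - 1))"
      by (intro mult_left_mono) auto
    then have "(65536 * 2 ^ n - 1) * (X - 1) * (Y - 1) \<le> 65535 * 2 ^ n * (X + 1) * (Y - 1)"
      unfolding eq[symmetric] by (simp add: mult.assoc)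
    then have "(65536 * 2 ^ n - 1) * (X - 1) \<le> 65535 * 2 ^ n * (X + 1)"
      using X65 \<open>X < Y\<close> by simp
    then show ?thesis
      by (simp add: algebra_simps)
  qed
  show X17: "X \<le> 174761"
  proof (rule ccontr)
    assume "\<not> X \<le> 174761"
    \<comment> \<open>Since n \<ge> 2, the estimate becomes 4 * (X - 131071) \<le> X - 1, that is 3
      * X \<le> 524283 = 3 * 174761.\<close>
    then have "4 * (X - 131071) \<le> 2 ^ n * (X - 131071)"
      using W by (intro mult_right_mono) auto
    then have "4 * (X - 131071) \<le> X - 1"
      using \<open>2 ^ n * (X - 131071) \<le> X - 1\<close> by (rule order_trans)
    then have "X + X + X \<le> 524283"
      by simp
    then show False
      using \<open>\<not> X \<le> 174761\<close> by simp
  qed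
  then show "g \<le> 174761"
    using gX by simp
  have "2 ^ n * 1 \<le> 2 ^ n * (X - 65536)"
    using X65 by (intro mult_left_mono) auto
  also have "\<dots> = X - 1 + F * ((2 ^ i * D) * g)"
    unfolding fermat_triple_A(3)[OF t] by (simp add: ac_simps)
  also have "\<dots> \<le> 174761 + F * (174761 * 174761)"
    using gX X17 pos by (intro add_mono mult_left_mono mult_mono) auto
  finally show "2 ^ n \<le> 174761 + F * 174761 ^ 2"
    by (simp add: power2_eq_square)
qed

section \<open>Splitting the cofactor of 2^(16 + n) - 1 into g and h\<close>

lemma primepow_coprime_factors:
  fixes P Q X :: int
  assumes "primepow X" "P dvd X" "Q dvd X" "coprime P Q" "1 < P"
  shows "is_unit Q"
proof (rule ccontr)
  assume "\<not> is_unit Q"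
  moreover have "Q \<noteq> 0"
    using assms primepow_pos_int[OF assms(1)] by auto
  ultimately obtain r where r: "prime r" "r dvd Q"
    using prime_divisor_exists[of Q] by auto
  obtain p where p: "prime p" "p dvd P"
    using prime_divisor_exists[of P] assms(5) by auto
  have "p = r"
    using primepow_prime_dvd_eq[OF assms(1) p(1) _ r(1)] p r assms by (meson dvd_trans)
  then show False
    using p r assms(4) by (meson coprime_common_divisor not_prime_unit)
qed

text \<open>If a prime p of P divides g, it is the only prime of g, so Q is coprime to g and divides
  h. The rest h / Q divides P, hence is coprime to Q; inside the prime power Y it must be 1.\<close>

lemma coprime_split_primepow:
  fixes P Q g h X Y :: int
  assumes "P * Q = g * h" "coprime P Q" "1 < P" "1 < Q" "0 < g" "0 < h"
    "primepow X" "primepow Y" "coprime X Y" "g dvd X" "h dvd Y"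
  shows "g = P \<and> h = Q \<or> g = Q \<and> h = P"
proof -
  have *: "g = P \<and> h = Q" if "P * Q = g * h" "coprime P Q" "1 < P" "1 < Q" "0 < g" "0 < h"
    "primepow X" "primepow Y" "coprime X Y" "g dvd X" "h dvd Y" "prime p" "p dvd P" "p dvd g"
    for P Q g h X Y p :: int
  proof -
    have "coprime Q g"
    proof (rule ccontr)
      assume "\<not> coprime Q g"
      then have "\<not> is_unit (gcd Q g)"
        by (simp add: coprime_iff_gcd_eq_1)
      moreover have "gcd Q g \<noteq> 0"
        using \<open>1 < Q\<close> by simp
      ultimately obtain r where "prime r" "r dvd gcd Q g"
        using prime_divisor_exists by blast
      then have r: "prime r" "r dvd Q" "r dvd g"
        by auto
      then have "r = p"
        using primepow_prime_dvd_eq[OF that(7)] that by (meson dvd_trans)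
      then show False
        using r that by (meson coprime_common_divisor not_prime_unit)
    qed
    then have "Q dvd h"
      using that(1) by (metis coprime_dvd_mult_right_iff dvd_triv_right)
    then obtain c where c: "h = Q * c" by (elim dvdE)
    have "0 < c"
      using c that by (metis zero_less_mult_pos less_trans zero_less_one)
    have "P = g * c"
      using that(1,4) c by simp
    have "c dvd Y" "Q dvd Y"
      using c \<open>h dvd Y\<close> by (auto elim: dvd_mult_left dvd_mult_right)
    moreover have "coprime Q c"
      using \<open>coprime P Q\<close> \<open>P = g * c\<close> by (simp add: coprime_commute)
    ultimately have "c = 1"
      using primepow_coprime_factors[of Y Q c] \<open>primepow Y\<close> \<open>1 < Q\<close> \<open>0 < c\<close> by simp
    then show ?thesis
      using c \<open>P = g * c\<close> by simp
  qed
  obtain p where p: "prime p" "p dvd P"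
    using prime_divisor_exists[of P] assms(3) by auto
  then have "p dvd g * h"
    using assms(1) by (metis dvd_mult2)
  then consider "p dvd g" | "p dvd h"
    using p by (auto simp: prime_dvd_mult_iff)
  then show ?thesis
  proof cases
    case 1
    then show ?thesis
      using *[OF assms(1-11) p] by simp
  next
    case 2
    have "P * Q = h * g" "coprime Y X"
      using assms by (simp_all add: ac_simps)
    then show ?thesis
      using *[of P Q h g Y X p] 2 assms p by simp
  qed
qed


text \<open>One of g and h would have to be P1 * P2, but neither X nor Y has two coprime nontrivial
  factors.\<close>

lemma fermat_triple_three_factors:
  assumes t: "fermat_triple n i k A B D E F g h X Y"
    and F: "gcd (65536 * 2 ^ n - 1) 65535 = (F' :: int)" "65536 * 2 ^ n - 1 = F' * (P1 * P2 * Q)"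
    and P: "coprime P1 P2" "coprime (P1 * P2) Q" "1 < P1" "1 < P2" "1 < Q"
  shows False
proof -
  have gh: "F * (g * h) = 65536 * 2 ^ n - 1" "F = gcd (65536 * 2 ^ n - 1) 65535" "0 < F"
    and pp: "primepow X" "primepow Y" "coprime X Y" "0 < g" "0 < h" and X: "X = B * g" "Y = A * h"
    using t unfolding fermat_triple_def by blast+
  have dv: "g dvd X" "h dvd Y"
    using X by simp_all
  have "F' * (P1 * P2 * Q) = F' * (g * h)" "0 < F'"
    using gh F by metis+
  then have "P1 * P2 * Q = g * h"
    by simp
  moreover have "1 * 1 < P1 * P2"
    using P by (intro mult_strict_mono) auto
  ultimately consider "g = P1 * P2" | "h = P1 * P2"
    using coprime_split_primepow[of "P1 * P2" Q g h X Y] P pp dv by auto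
  then have "is_unit P2"
  proof cases
    case 1
    then show ?thesis
      using primepow_coprime_factors[OF pp(1) _ _ P(1,3)] dv(1) by (auto elim: dvd_mult_left dvd_mult_right)
  next
    case 2
    then show ?thesis
      using primepow_coprime_factors[OF pp(2) _ _ P(1,3)] dv(2) by (auto elim: dvd_mult_left dvd_mult_right)
  qed
  then show False
    using P(4) by simp
qed

text \<open>The quotient is g * h, a divisor of X * Y. This excludes every n for which it shares a
  prime with 65535.\<close>

lemma fermat_triple_coprime:
  assumes t: "fermat_triple n i k A B D E F g h X Y"
  shows "coprime ((65536 * 2 ^ n - 1) div gcd (65536 * 2 ^ n - 1) 65535) (65535::int)"
proof -
  have "F * (g * h) = 65536 * 2 ^ n - 1" "F = gcd (65536 * 2 ^ n - 1) 65535" "0 < F"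
    and X: "X = B * g" "Y = A * h" "coprime X 65535" "coprime Y 65535"
    using t unfolding fermat_triple_def by blast+
  then have "(65536 * 2 ^ n - 1) div gcd (65536 * 2 ^ n - 1) 65535 = g * h"
    by (metis nonzero_mult_div_cancel_left less_irrefl)
  moreover have "coprime (g * h) 65535"
    using X by simp
  ultimately show ?thesis
    by simp
qed

text \<open>
  Given \<open>n\<close>, \<open>F\<close>, \<open>g\<close> and \<open>h\<close>, the equations of \<open>fermat_triple_A\<close> determine \<open>A\<close> and \<open>B\<close> from \<open>k\<close> and \<open>E\<close>;
  below \<open>x\<close> and \<open>y\<close> stand for \<open>2 ^ k\<close> and \<open>2 ^ i\<close>.
\<close>

definition both_pp :: "int \<Rightarrow> int \<Rightarrow> bool" where
  "both_pp a b = (if a = 1 then True else if b = 1 then True else gcd a b \<noteq> 1)"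

text \<open>True reports a contradiction: the products A * h = Y and B * g = X violate a necessary
  condition for being prime powers coprime to 65535.\<close>

definition refuted4 :: "int \<Rightarrow> int \<Rightarrow> int \<Rightarrow> int \<Rightarrow> bool" where
  "refuted4 A h B g = (if both_pp A h then if both_pp B g then if gcd (A * h) 65535 = 1 then gcd (B * g) 65535 \<noteq> 1
     else True else True else True)"
definition refuted3 :: "int \<Rightarrow> int \<Rightarrow> int \<Rightarrow> int \<Rightarrow> int \<Rightarrow> bool" where
  "refuted3 w a b g h = (if a mod w = 0 then if b mod w = 0 then refuted4 (a div w) h (b div w) g else True else True)"
definition refuted2 :: "int \<Rightarrow> int \<Rightarrow> int \<Rightarrow> int \<Rightarrow> int \<Rightarrow> int \<Rightarrow> int \<Rightarrow> int \<Rightarrow> bool" where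
  "refuted2 w F g h x y E D = refuted3 w (F * (g + x * E)) (F * (h + y * D)) g h"

text \<open>The product x * y = 2^n is kept while k rises from 1 and i falls to 1; both exponents
  are positive, so the loop ends at y = 1.\<close>

function refuted1 :: "int \<Rightarrow> int \<Rightarrow> int \<Rightarrow> int \<Rightarrow> int \<Rightarrow> int \<Rightarrow> int \<Rightarrow> int \<Rightarrow> bool" where
  "refuted1 w F g h E D x y = (if y < 2 then True else
     if refuted2 w F g h x y E D then refuted1 w F g h E D (2 * x) (y div 2) else False)"
  by auto
termination by (relation "measure (\<lambda>(w, F, g, h, E, D, x, y). nat y)") auto
declare refuted1.simps [simp del]

definition refuted_divisor where "refuted_divisor w F g h R y E = refuted1 w F g h E (R div E) 2 y"
definition refuted where "refuted ps w F g h R y = check_divisors ps (refuted_divisor w F g h R y) 1"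

lemma refuted1_covers:
  assumes "refuted1 w F g h E D x (2 ^ j)" "s < j"
  shows "refuted2 w F g h (x * 2 ^ s) (2 ^ (j - s)) E D"
  using assms
proof (induction s arbitrary: x j)
  case 0
  have "(2::int) ^ 1 \<le> 2 ^ j"
    using 0 by (intro power_increasing) auto
  then show ?case
    using 0 by (simp add: refuted1.simps[of w F g h E D x] split: if_splits)
next
  case (Suc s)
  then obtain l where l: "j = Suc l"
    by (cases j) auto
  have "1 \<le> (2::int) ^ l"
    by simp
  then have "\<not> (2::int) ^ j < 2" "(2::int) ^ j div 2 = 2 ^ l"
    unfolding l by (simp_all add: not_less)
  then have "refuted1 w F g h E D (2 * x) (2 ^ l)"
    using Suc.prems(1) by (metis refuted1.simps)
  then have "refuted2 w F g h (2 * x * 2 ^ s) (2 ^ (l - s)) E D"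
    using Suc.prems l by (intro Suc.IH) auto
  then show ?case
    using l by (simp add: ac_simps)
qed

lemma both_pp_primepow:
  assumes "primepow (a * b)" "0 < a" "0 < b"
  shows "both_pp a b"
  using primepow_coprime_factors[OF assms(1), of a b] assms(2,3)
  by (auto simp: both_pp_def coprime_iff_gcd_eq_1)

text \<open>Since D * E = 65535 / F is the product of \<open>ps\<close>, only the divisor E and the
  exponent k remain free once g and h are given.\<close>

lemma fermat_triple_refuted:
  assumes t: "fermat_triple n i k A B D E F g h X Y"
    and r: "refuted ps (2 ^ n - 1) F g h (prod_list ps) (2 ^ (n - 1))"
    and F: "F * prod_list ps = 65535" and ps: "\<And>p. p \<in> set ps \<Longrightarrow> prime p"
  shows False
proof -
  have pos: "0 < A" "0 < B" "0 < g" "0 < h" "0 < D" "0 < E" "0 < F" and n: "n = i + k" "0 < i" "0 < k"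
    and X: "X = B * g" "Y = A * h" "coprime X 65535" "coprime Y 65535" "primepow X" "primepow Y"
    and DEF: "D * (E * F) = 65535"
    using t unfolding fermat_triple_def by blast+
  have "F * (D * E) = F * prod_list ps"
    using DEF F by (simp add: ac_simps)
  then have R: "prod_list ps = D * E"
    using pos by simp
  have "refuted_divisor (2 ^ n - 1) F g h (prod_list ps) (2 ^ (n - 1)) (1 * E)"
    by (rule check_divisors_covers[OF r[unfolded refuted_def]]) (use R pos ps in auto)
  then have "refuted1 (2 ^ n - 1) F g h E D 2 (2 ^ (n - 1))"
    using R pos by (simp add: refuted_divisor_def)
  then have "refuted2 (2 ^ n - 1) F g h (2 * 2 ^ (k - 1)) (2 ^ (n - 1 - (k - 1))) E D"
    by (rule refuted1_covers) (use n in auto)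
  moreover have "2 * 2 ^ (k - 1) = (2::int) ^ k" "n - 1 - (k - 1) = i"
    using n by (auto simp: power_eq_if)
  ultimately have r2: "refuted2 (2 ^ n - 1) F g h (2 ^ k) (2 ^ i) E D"
    by simp
  have "(2::int) ^ 1 \<le> 2 ^ n"
    using n by (intro power_increasing) auto
  then have w: "0 < (2::int) ^ n - 1"
    by simp
  have *: "((2 ^ n - 1) * A) mod (2 ^ n - 1) = 0" "((2 ^ n - 1) * B) mod (2 ^ n - 1) = 0"
    "((2 ^ n - 1) * A) div (2 ^ n - 1) = A" "((2 ^ n - 1) * B) div (2 ^ n - 1) = B"
    using w by auto
  have "refuted4 A h B g"
    using r2 unfolding refuted2_def refuted3_def fermat_triple_A(1,2)[OF t, symmetric] * by simp
  moreover have "both_pp A h" "both_pp B g"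
    using both_pp_primepow X pos by blast+
  ultimately show False
    using X by (simp add: refuted4_def coprime_iff_gcd_eq_1 split: if_splits)
qed

section \<open>Primality of the cofactors that do not split\<close>

lemma prime_524287: "prime (524287 :: int)"
proof -
  have "prime_factor_list 2 524287 = [524287]"
    by code_simp
  then have "524287 \<in> set (prime_factor_list 2 524287)"
    by (simp only: list.set insert_iff simp_thms)
  then show ?thesis
    by (rule prime_factor_list_2(2)[rotated]) simp
qed

lemma prime_65537: "prime (65537 :: int)"
proof -
  have "prime_factor_list 2 65537 = [65537]"
    by code_simp
  then have "65537 \<in> set (prime_factor_list 2 65537)"
    by (simp only: list.set insert_iff simp_thms)
  then show ?thesis
    by (rule prime_factor_list_2(2)[rotated]) simp
qed

text \<open>2147483647 = 2^31 - 1, so 2 has prime order 31 modulo r and 31 divides r - 1; r is odd,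
  so 62 does too.\<close>

lemma prime_dvd_mersenne_31:
  fixes r :: int
  assumes "prime r" "r dvd 2147483647"
  shows "\<exists>j. r = 63 + 62 * int j"
proof -
  define s where "s = nat r"
  have r: "r = int s"
    using prime_gt_0_int[OF assms(1)] by (simp add: s_def)
  have "int s dvd int 2147483647"
    using assms(2) unfolding r by simp
  then have s: "prime s" "s dvd 2147483647"
    using assms(1) unfolding r int_dvd_int_iff by simp_all
  have "s \<noteq> 2"
    using s(2) by auto
  then have "2 < s"
    using prime_ge_2_nat[OF s(1)] by linarith
  then have "odd s"
    using s(1) prime_odd_nat by blast
  have "s dvd 2 ^ 31 - 1"
    using s(2) by simp
  then have "[2 ^ 31 = 1] (mod s)"
    by (subst cong_altdef_nat) simp_all
  then have "ord s 2 dvd 31"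
    unfolding ord_divides .
  moreover have "ord s 2 \<noteq> 1"
  proof
    assume "ord s 2 = 1"
    then have "[2 ^ 1 = 1] (mod s)"
      unfolding ord_divides by simp
    then have "s dvd 2 ^ 1 - 1"
      by (subst (asm) cong_altdef_nat) simp_all
    then have "s dvd 1"
      by simp
    then show False
      using s(1) by simp
  qed
  moreover have "prime (31 :: nat)"
    by simp
  ultimately have "ord s 2 = 31"
    by (metis prime_nat_iff)
  have "coprime s 2"
    using \<open>odd s\<close> by simp
  then have "31 dvd s - 1"
    using order_divides_totient[of s 2] s(1) \<open>ord s 2 = 31\<close> by (simp add: totient_prime)
  moreover have "2 dvd s - 1"
    using \<open>odd s\<close> by simp
  ultimately have "31 * 2 dvd s - 1"
    by (intro divides_mult) auto
  then obtain c where c: "s - 1 = 62 * c"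
    by auto
  have "1 < s"
    using s(1) by (rule prime_gt_1_nat)
  then obtain j where "c = Suc j"
    using c by (cases c) auto
  then have "r = 63 + 62 * int j"
    using c \<open>1 < s\<close> r by simp
  then show ?thesis ..
qed

definition not_dvd :: "int \<Rightarrow> int \<Rightarrow> bool" where "not_dvd n r \<longleftrightarrow> n mod r \<noteq> 0"

text \<open>Trial division only visits the class of 1 modulo 62, from 63 up to 46341, the least
  integer whose square exceeds 2^31 - 1.\<close>

lemma prime_2147483647: "prime (2147483647 :: int)"
proof (rule prime_if_less_square)
  show "46341 \<le> r" if r: "prime r" "r dvd 2147483647" for r :: int
  proof (rule ccontr)
    assume "\<not> 46341 \<le> r"
    obtain j where j: "r = 63 + 62 * int j"
      using prime_dvd_mersenne_31[OF r] by auto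
    have "check_range 62 (not_dvd 2147483647) 63 46341"
      by code_simp
    then have "not_dvd 2147483647 (63 + 62 * int j)"
      by (rule check_range_covers) (use \<open>\<not> 46341 \<le> r\<close> j in auto)
    then show False
      using r(2) j by (auto simp: not_dvd_def)
  qed
qed simp_all

text \<open>
  The tables below cover all \<open>n\<close> with \<open>2 \<le> n \<le> 50\<close> by pairwise coprime factors of \<open>2 ^ (16 + n) - 1\<close>
  divided by its greatest common divisor with 65535. This quotient is \<open>g * h\<close>, and \<open>g\<close>, \<open>h\<close> are powers
  of two primes or 1, so three factors are too many and two factors are \<open>g\<close> and \<open>h\<close>.
\<close>

definition exps_ok :: "nat \<Rightarrow> int \<Rightarrow> int list \<Rightarrow> bool" where
  "exps_ok n w ps \<longleftrightarrow> list_all (list_mem [3, 5, 17, 257]) ps \<and>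
     65536 * 2 ^ n - 1 = gcd (65536 * 2 ^ n - 1) 65535 * w \<and> gcd (65536 * 2 ^ n - 1) 65535 * prod_list ps = 65535"

text \<open>The pair is ordered: g belongs to the smaller prime power X, and g > 174761 contradicts
  \<open>fermat_triple_bounds\<close>. Both orders must therefore be tested.\<close>

definition pair_ok :: "nat \<Rightarrow> int list \<Rightarrow> int \<Rightarrow> int \<Rightarrow> bool" where
  "pair_ok n ps g h \<longleftrightarrow> (if 174761 < g then True
     else refuted ps (2 ^ n - 1) (gcd (65536 * 2 ^ n - 1) 65535) g h (prod_list ps) (2 ^ (n - 1)))"

lemma fermat_triple_cofactors:
  assumes t: "fermat_triple n i k A B D E F g h X Y" and ok: "exps_ok n w ps"
  shows "w = g * h" "\<not> pair_ok n ps g h"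
proof -
  have gh: "F * (g * h) = 65536 * 2 ^ n - 1" "F = gcd (65536 * 2 ^ n - 1) 65535" "0 < F"
    using t unfolding fermat_triple_def by blast+
  have "F * w = F * (g * h)" and ps: "F * prod_list ps = 65535" and mem: "\<forall>p\<in>set ps. p \<in> set [3, 5, 17, 257]"
    using ok gh unfolding exps_ok_def list_all_iff list_mem_iff by metis+
  then show "w = g * h"
    using gh(3) by simp
  have "prime p" if "p \<in> set ps" for p
    using that mem by auto
  then have "\<not> refuted ps (2 ^ n - 1) F g h (prod_list ps) (2 ^ (n - 1))"
    using fermat_triple_refuted[OF t _ ps] by blast
  then show "\<not> pair_ok n ps g h"
    using fermat_triple_bounds(2)[OF t] unfolding pair_ok_def gh(2) by simp
qed

definition two_factors :: "(nat \<times> int \<times> int \<times> int list) list" where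
  "two_factors = [(7, 47, 178481, [3, 5, 17, 257]), (10, 2731, 8191, [5, 17, 257]), (18, 43691, 131071, [5, 17, 257]), (21, 223, 616318177, [3, 5, 17, 257]), (22, 174763, 524287, [5, 17, 257]), (25, 13367, 164511353, [3, 5, 17, 257]), (33, 127, 4432676798593, [3, 5, 17, 257])]"

fun two_factors_ok :: "nat \<times> int \<times> int \<times> int list \<Rightarrow> bool" where
  "two_factors_ok (n, P, Q, ps) \<longleftrightarrow> gcd P Q = 1 \<and> 1 < P \<and> 1 < Q \<and> exps_ok n (P * Q) ps \<and> pair_ok n ps P Q \<and> pair_ok n ps Q P"

lemma two_factors_ok: "list_all two_factors_ok two_factors"
  by code_simp

lemma fermat_triple_two_factors:
  assumes t: "fermat_triple n i k A B D E F g h X Y" and ok: "two_factors_ok (n, P, Q, ps)"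
  shows False
proof -
  have pp: "primepow X" "primepow Y" "coprime X Y" "0 < g" "0 < h" and X: "X = B * g" "Y = A * h"
    using t unfolding fermat_triple_def by blast+
  have dv: "g dvd X" "h dvd Y"
    using X by simp_all
  have PQ: "coprime P Q" "1 < P" "1 < Q" and ok': "exps_ok n (P * Q) ps" "pair_ok n ps P Q" "pair_ok n ps Q P"
    using ok by (simp_all only: two_factors_ok.simps coprime_iff_gcd_eq_1)
  note gh = fermat_triple_cofactors[OF t ok'(1)]
  have "g = P \<and> h = Q \<or> g = Q \<and> h = P"
    by (rule coprime_split_primepow[OF gh(1) PQ pp(4,5) pp(1-3) dv])
  then show False
    using gh(2) ok' by blast
qed

text \<open>The exponents 19 and 31 give Mersenne primes, and 2^32 - 1 = 65535 * 65537. In each case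
  the cofactor is prime, so g or h is 1.\<close>

definition mersenne_cofactors :: "(nat \<times> int \<times> int list) list" where
  "mersenne_cofactors = [(3, 524287, [3, 5, 17, 257]), (15, 2147483647, [3, 5, 17, 257]), (16, 65537, [])]"

fun one_factor_ok :: "nat \<times> int \<times> int list \<Rightarrow> bool" where
  "one_factor_ok (n, P, ps) \<longleftrightarrow> exps_ok n P ps \<and> pair_ok n ps 1 P \<and> pair_ok n ps P 1 \<and> list_mem [524287, 2147483647, 65537] P"

lemma mersenne_cofactors_ok: "list_all one_factor_ok mersenne_cofactors"
  by code_simp

lemma fermat_triple_one_factor:
  assumes t: "fermat_triple n i k A B D E F g h X Y" and ok: "one_factor_ok (n, P, ps)"
  shows False
proof -
  have pp: "0 < g" "0 < h"
    using t unfolding fermat_triple_def by blast+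
  have ok': "exps_ok n P ps" "pair_ok n ps 1 P" "pair_ok n ps P 1" "P \<in> set [524287, 2147483647, 65537]"
    using ok by (simp_all only: one_factor_ok.simps list_mem_iff)
  have "prime P"
    using ok'(4) prime_524287 prime_2147483647 prime_65537 unfolding list.set by blast
  note gh = fermat_triple_cofactors[OF t ok'(1)]
  have "g dvd P"
    unfolding gh(1) by simp
  then have "g = 1 \<or> g = P"
    using \<open>prime P\<close> pp(1) unfolding prime_int_iff by auto
  then have "g = 1 \<and> h = P \<or> g = P \<and> h = 1"
    using pp gh(1) by auto
  then show False
    using gh(2) ok' by blast
qed

definition non_coprime_exps :: "nat list" where "non_coprime_exps = [2, 4, 8, 14, 20, 24, 26, 32]"
text \<open>F equals 2^gcd(n, 16) - 1. For these n it is small enough that the bound on 2^n already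
  fails.\<close>

definition large_exps :: "nat list" where "large_exps = [35, 37, 38, 39, 41, 42, 43, 44, 45, 46, 47, 49, 50]"
definition three_factors :: "(nat \<times> int \<times> int \<times> int) list" where
  "three_factors = [(5, 49, 127, 337), (6, 23, 89, 683), (9, 31, 601, 1801), (11, 7, 73, 262657), (12, 29, 43, 14351), (13, 233, 1103, 2089), (17, 7, 23, 53353631), (19, 31, 71, 15610967), (23, 7, 79, 994133479), (27, 431, 9719, 2099863), (28, 23, 89, 572942063), (29, 7, 31, 162139963543), (30, 47, 178481, 2796203), (31, 2351, 4513, 13264529), (34, 11, 31, 1100586419201), (36, 53, 157, 36082198673), (40, 29, 43, 226606896671), (48, 641, 65537, 6700417)]"

fun three_factors_ok :: "nat \<times> int \<times> int \<times> int \<Rightarrow> bool" where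
  "three_factors_ok (n, P1, P2, Q) \<longleftrightarrow> gcd P1 P2 = 1 \<and> gcd (P1 * P2) Q = 1 \<and> 1 < P1 \<and> 1 < P2 \<and> 1 < Q \<and>
     65536 * 2 ^ n - 1 = gcd (65536 * 2 ^ n - 1) 65535 * (P1 * P2 * Q)"

lemma three_factors_ok: "list_all three_factors_ok three_factors"
  by code_simp

definition non_coprime_exp :: "nat \<Rightarrow> bool" where
  "non_coprime_exp n \<longleftrightarrow> gcd ((65536 * 2 ^ n - 1) div gcd (65536 * 2 ^ n - 1) 65535) (65535 :: int) \<noteq> 1"

lemma non_coprime_exps: "list_all non_coprime_exp non_coprime_exps"
  by code_simp

definition large_exp :: "nat \<Rightarrow> bool" where
  "large_exp n \<longleftrightarrow> 174761 + gcd (65536 * 2 ^ n - 1) 65535 * 174761 ^ 2 < (2 :: int) ^ n"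

lemma large_exps: "list_all large_exp large_exps"
  by code_simp

lemma exps_cases: "set [2..<51] \<subseteq>
  set (non_coprime_exps @ large_exps @ map fst mersenne_cofactors @ map fst two_factors @ map fst three_factors)"
  by code_simp

lemma no_fermat_triple:
  assumes t: "fermat_triple n i k A B D E F g h X Y"
  shows False
proof -
  have F: "F = gcd (65536 * 2 ^ n - 1) 65535" "0 < F" "n = i + k" "0 < i" "0 < k"
    using t unfolding fermat_triple_def by blast+
  have "F \<le> 65535"
    unfolding F(1) by (intro zdvd_imp_le) auto
  have "n < 51"
  proof (rule ccontr)
    assume "\<not> n < 51"
    \<comment> \<open>For F = 65535 the bound is about 2.0 * 10^15, which lies between 2^50 and
      2^51.\<close>
    then have "(2::int) ^ 51 \<le> 2 ^ n"
      by (intro power_increasing) auto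
    also have "\<dots> \<le> 174761 + F * 174761 ^ 2"
      by (rule fermat_triple_bounds(3)[OF t])
    also have "\<dots> \<le> 174761 + 65535 * 174761 ^ 2"
      using \<open>F \<le> 65535\<close> by simp
    finally show False
      by simp
  qed
  then have "n \<in> set [2..<51]"
    unfolding set_upt using F(3-5) by simp
  then have "n \<in> set (non_coprime_exps @ large_exps @ map fst mersenne_cofactors @ map fst two_factors @ map fst three_factors)"
    using exps_cases by (rule set_rev_mp)
  then consider P ps where "(n, P, ps) \<in> set mersenne_cofactors" | "n \<in> set non_coprime_exps" | "n \<in> set large_exps"
    | P1 P2 Q where "(n, P1, P2, Q) \<in> set three_factors" | P Q ps where "(n, P, Q, ps) \<in> set two_factors"
    by (auto simp del: set_upt)
  then show False
  proof cases
    case (1 P ps)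
    with mersenne_cofactors_ok have "one_factor_ok (n, P, ps)"
      unfolding list_all_iff by (rule bspec)
    then show False
      by (rule fermat_triple_one_factor[OF t])
  next
    case 2
    with non_coprime_exps have "non_coprime_exp n"
      unfolding list_all_iff by (rule bspec)
    then show False
      using fermat_triple_coprime[OF t] unfolding non_coprime_exp_def coprime_iff_gcd_eq_1 by contradiction
  next
    case 3
    with large_exps have "large_exp n"
      unfolding list_all_iff by (rule bspec)
    then have "174761 + F * 174761 ^ 2 < 2 ^ n"
      unfolding large_exp_def F(1) .
    then show False
      using fermat_triple_bounds(3)[OF t] by simp
  next
    case (4 P1 P2 Q)
    with three_factors_ok have "three_factors_ok (n, P1, P2, Q)"
      unfolding list_all_iff by (rule bspec)
    then show False
      using fermat_triple_three_factors[OF t refl, of P1 P2 Q]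
      by (simp only: three_factors_ok.simps coprime_iff_gcd_eq_1) blast
  next
    case (5 P Q ps)
    with two_factors_ok have "two_factors_ok (n, P, Q, ps)"
      unfolding list_all_iff by (rule bspec)
    then show False
      by (rule fermat_triple_two_factors[OF t])
  qed
qed

section \<open>The theorem\<close>

text \<open>65536 divides the product of S, and by coprimality only one element z is even; hence z
  is a power of 2 with exponent at least 16, and the other two elements are X and Y.\<close>

lemma no_fermat_tail_of_card_3:
  assumes sys: "tail_system S 3 65535 65536 65535 lo" and "card S = 3"
  shows False
proof -
  have fin: "finite S" and eq: "65535 * \<Prod>S = 65536 * (\<Prod>q\<in>S. q - 1)" and cop: "pairwise coprime S"
    and el: "\<And>q. q \<in> S \<Longrightarrow> primepow q \<and> coprime q 65535"
    using sys by (auto simp: tail_system_def)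
  have "2 dvd \<Prod>S"
    using tail_system_dvd_prod[OF sys] by (rule dvd_trans[rotated]) simp
  then obtain z where z: "z \<in> S" "2 dvd z"
    using fin by (auto simp: prime_dvd_prod_iff)
  have "card (S - {z}) = 2"
    using fin z \<open>card S = 3\<close> by simp
  then obtain X0 Y0 where "S - {z} = {X0, Y0}" "X0 \<noteq> Y0"
    by (auto simp: card_2_iff)
  then obtain X Y where XY: "S - {z} = {X, Y}" "X < Y"
    by (metis insert_commute linorder_neq_iff)
  have S: "S = {z, X, Y}" "z \<noteq> X" "z \<noteq> Y"
    using XY z by auto
  have cops: "coprime X Y" "coprime z X" "coprime z Y"
    using cop S XY by (auto simp: pairwise_def)
  then have "odd X" "odd Y"
    using z by (metis coprime_common_divisor odd_one)+
  have prods: "\<Prod>S = z * (X * Y)" "(\<Prod>q\<in>S. q - 1) = (z - 1) * ((X - 1) * (Y - 1))"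
    using S XY by auto
  have "65536 dvd z * (X * Y)"
    using tail_system_dvd_prod[OF sys] prods by simp
  moreover have "coprime (65536 :: int) (X * Y)"
  proof -
    have "coprime ((2::int) ^ 16) (X * Y)"
      unfolding coprime_power_left_iff using \<open>odd X\<close> \<open>odd Y\<close> by simp
    then show ?thesis by simp
  qed
  ultimately have "65536 dvd z"
    by (simp add: coprime_dvd_mult_left_iff)
  obtain s a where s: "prime s" "z = s ^ a"
    using el[OF z(1)] by (auto simp: primepow_def)
  have "prime (2 :: int)"
    by simp
  then have "2 dvd s"
    using z(2) s(2) by (metis prime_dvd_power)
  then have "s = 2"
    using s(1) \<open>prime (2 :: int)\<close> by (metis primes_dvd_imp_eq)
  have "(2::int) ^ 16 dvd 2 ^ a"
    using \<open>65536 dvd z\<close> s(2) \<open>s = 2\<close> by simp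
  then have "16 \<le> a"
    using dvd_power_iff[of "2 :: int" 16 a] by simp
  then have zn: "z = 65536 * 2 ^ (a - 16)"
    using s(2) \<open>s = 2\<close> power_add[of "2 :: int" 16 "a - 16"] by simp
  have "65536 * (65535 * (2 ^ (a - 16) * (X * Y))) = 65536 * ((X - 1) * ((Y - 1) * (65536 * 2 ^ (a - 16) - 1)))"
    using eq unfolding prods zn by (simp add: ac_simps)
  then have "65535 * (2 ^ (a - 16) * (X * Y)) = (X - 1) * ((Y - 1) * (65536 * 2 ^ (a - 16) - 1))"
    by (simp only: mult_cancel_left) simp
  then obtain i k A B D E F g h where "fermat_triple (a - 16) i k A B D E F g h X Y"
    using el S cops \<open>odd X\<close> \<open>odd Y\<close> XY(2) by (elim fermat_triple_exists) auto
  then show False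
    by (rule no_fermat_triple)
qed

text \<open>Three elements are impossible by the arithmetic above. For at most two, the one prime 2
  of the numerator is enough for the smooth enumeration, so a search of depth 2 is short.\<close>

lemma fermat_branch: fermat_branch
  unfolding fermat_branch_def
proof (intro allI impI)
  fix S lo
  assume sys: "tail_system S 3 65535 65536 65535 lo"
  then have "card S \<le> 2"
    using no_fermat_tail_of_card_3[OF sys] by (auto simp: tail_system_def le_Suc_eq numeral_3_eq_3)
  moreover have "1 < lo"
    using sys by (simp add: tail_system_def)
  ultimately have "tail_system S 2 65535 65536 65535 2"
    by (intro tail_system_mono[OF sys]) auto
  moreover have "search 2 [] 65535 65536 65535 2"
    by code_simp
  ultimately show "65535 * \<Prod>S \<in> set solutions"
    using search_sound[of 2] by (auto simp: sound_for_def)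
qed

definition search_ratio :: "int \<Rightarrow> bool" where
  "search_ratio k \<longleftrightarrow> search 7 [] 1 k 1 2"

lemma search_ratios: "list_all search_ratio [1..8]"
  by code_simp

theorem theorem1p1:
  fixes N :: nat
  assumes "N > 0"
    and "unitary_totient N dvd N"
    and "N \<notin> {1, 2, 2 * 3, 2^2 * 3, 2^3 * 3 * 7, 2^4 * 3 * 5, 2^5 * 3 * 5 * 31,
      2^8 * 3 * 5 * 17, 2^11 * 3 * 5 * 11^2 * 23 * 89, 2^16 * 3 * 5 * 17 * 257,
      2^17 * 3 * 5 * 17 * 257 * 131071, 2^32 * 3 * 5 * 17 * 257 * 65537}"
  shows "card (prime_factors N) \<ge> 8"
proof (rule ccontr)
  assume "\<not> 8 \<le> card (prime_factors N)"
  then have card: "card (prime_factors N) \<le> 7"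
    by simp
  define f where "f p = p ^ multiplicity p N" for p
  define S where "S = (\<lambda>p. int (f p)) ` prime_factors N"
  have f: "prime p" "1 < f p" if "p \<in> prime_factors N" for p
  proof -
    show "prime p"
      using that by auto
    have "0 < multiplicity p N"
      using that by (simp add: prime_factors_multiplicity)
    then show "1 < f p"
      unfolding f_def using prime_gt_1_nat[OF \<open>prime p\<close>] by (intro one_less_power)
  qed
  have cop: "coprime (f p) (f q)" if "p \<in> prime_factors N" "q \<in> prime_factors N" "p \<noteq> q" for p q
    unfolding f_def using that f(1) by (simp add: primes_coprime)
  have inj: "inj_on (\<lambda>p. int (f p)) (prime_factors N)"
  proof (rule inj_onI, rule ccontr)
    fix p q assume *: "p \<in> prime_factors N" "q \<in> prime_factors N" "int (f p) = int (f q)" "p \<noteq> q"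
    then show False
      using cop[of p q] f(2)[of p] by simp
  qed
  have prodS: "\<Prod>S = int N"
  proof -
    have "\<Prod>S = (\<Prod>p\<in>prime_factors N. int (f p))"
      unfolding S_def using inj by (simp add: prod.reindex)
    also have "\<dots> = int (\<Prod>p\<in>prime_factors N. f p)"
      by simp
    also have "(\<Prod>p\<in>prime_factors N. f p) = N"
      using prod_prime_factors[of N] assms(1) by (simp add: f_def)
    finally show ?thesis .
  qed
  have prodS1: "(\<Prod>q\<in>S. q - 1) = int (unitary_totient N)"
  proof -
    have "(\<Prod>q\<in>S. q - 1) = (\<Prod>p\<in>prime_factors N. int (f p) - 1)"
      unfolding S_def using inj by (simp add: prod.reindex)
    also have "\<dots> = (\<Prod>p\<in>prime_factors N. int (f p - 1))"
      using f(2) by (intro prod.cong refl) (force simp: of_nat_diff)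
    finally show ?thesis
      by (simp add: unitary_totient_def f_def)
  qed
  obtain k where k: "N = unitary_totient N * k"
    using assms(2) by (elim dvdE)
  then have "0 < k"
    using assms(1) by (intro gr0I) auto
  have sys: "tail_system S 7 1 (int k) 1 2"
    unfolding tail_system_def
  proof (intro conjI ballI)
    show "finite S" "card S \<le> 7"
      using card inj by (simp_all add: S_def card_image)
    show "0 < int k" "(0::int) < 1" "coprime (int k) 1" "(1::int) < 2"
      using \<open>0 < k\<close> by simp_all
    show "1 * \<Prod>S = int k * (\<Prod>q\<in>S. q - 1)"
      unfolding prodS prodS1 using arg_cong[OF k, of int] by (simp add: mult.commute)
    show "pairwise coprime S"
      unfolding S_def using cop by (auto simp: pairwise_def)
    fix q assume "q \<in> S"
    then obtain p where p: "p \<in> prime_factors N" "q = int (f p)"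
      by (auto simp: S_def)
    show "2 \<le> q" "coprime q 1"
      using f(2)[OF p(1)] p(2) by simp_all
    have "prime (int p)" "q = int p ^ multiplicity p N" "0 < multiplicity p N"
      using p by (auto simp: f_def prime_factors_multiplicity)
    then show "primepow q"
      unfolding primepow_def by blast
  qed
  \<comment> \<open>The telescoping bound for seven elements from 2 on: 2/1 * 3/2 * ... * 8/7 =
    8.\<close>
  have "int k \<le> 8"
    using tail_system_le[OF sys] by simp
  then have "int k \<in> set [1..8]"
    unfolding set_upto using \<open>0 < k\<close> by simp
  with search_ratios have "search_ratio (int k)"
    unfolding list_all_iff by (rule bspec)
  then have "search 7 [] 1 (int k) 1 2"
    by (simp only: search_ratio_def)
  then have "1 * \<Prod>S \<in> set solutions"
    using search_sound[of 7] fermat_branch sys unfolding sound_for_def by (metis list.set(1) empty_iff)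
  then have "int N \<in> set solutions"
    by (simp add: prodS)
  then show False
    using assms(3) by (auto simp: solutions_def simp flip: of_nat_eq_iff)
qed

end
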